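(* Let $(\mathscr{A},\mathscr{E})$ be an exact category, let $A'\xrightarrow{i}A\xrightarrow{p}A''$ be a short exact sequence, and let $P'_\bullet\xrightarrow{\varepsilon'}A'$ and $P''_\bullet\xrightarrow{\varepsilon''}A''$ be projective resolutions. Then the direct sums $P_n=P'_n\oplus P''_n$ assemble to a projective resolution $P_\bullet\xrightarrow{\varepsilon}A$ of $A$ in such a way that there is a commutative diagram with exact rows and columns $$\begin{array}{ccccccccc} \cdots & \to & P'_2 & \to & P'_1 & \to & P'_0 & \xrightarrow{\varepsilon'} & A'\\ & & \downarrow & & \downarrow & & \downarrow & & {\scriptstyle i}\downarrow\\ \cdots & \to & P_2 & \to & P_1 & \to & P_0 & \xrightarrow{\varepsilon} & A\\ & & \downarrow & & \downarrow & & \downarrow & & {\scriptstyle p}\downarrow\\ \cdots & \to & P''_2 & \to & P''_1 & \to & P''_0 & \xrightarrow{\varepsilon''} & A''\end{array}$$ whose top and bottom rows are the given resolutions, whose rightmost column is the given short exact sequence, and whose remaining columns are $P'_n\xrightarrow{\left[\begin{smallmatrix}1\\0\end{smallmatrix}\right]}P'_n\oplus P''_n\xrightarrow{\left[\begin{smallmatrix}0&1\end{smallmatrix}\right]}P''_n$.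
   Context: A kernel-cokernel pair in an additive category $\mathscr{A}$ is a pair of composable morphisms $A'\xrightarrow{i}A\xrightarrow{p}A''$ such that $i$ is a kernel of $p$ and $p$ is a cokernel of $i$. Given a class $\mathscr{E}$ of kernel-cokernel pairs, an admissible monic is a morphism $i$ for which there is $p$ with $(i,p)\in\mathscr{E}$; an admissible epic is a morphism $p$ for which there is $i$ with $(i,p)\in\mathscr{E}$. An exact structure on $\mathscr{A}$ is a class $\mathscr{E}$ of kernel-cokernel pairs closed under isomorphisms such that: all identity morphisms are admissible monics and admissible epics; admissible monics are closed under composition and admissible epics are closed under composition; the push-out of an admissible monic along an arbitrary morphism exists and yields an admissible monic; the pull-back of an admissible epic along an arbitrary morphism exists and yields an admissible epic. An exact category is a pair $(\mathscr{A},\mathscr{E})$ of an additive category and an exact structure on it; elements of $\mathscr{E}$ are called short exact sequences. An object $P$ is projective if $\mathrm{Hom}_{\mathscr{A}}(P,-):\mathscr{A}\to\mathbf{Ab}$ sends short exact sequences of $\mathscr{E}$ to short exact sequences of abelian groups. A complex is exact (acyclic) if each differential factors as an admissible epic followed by an admissible monic, $X_{n+1}\to Z_n\to X_n$, in such a way that each sequence $Z_n\to X_n\to Z_{n-1}$ is in $\mathscr{E}$. A projective resolution of $A$ is a complex $P_\bullet$ of projective objects with $P_n=0$ for $n<0$ together with a morphism $P_0\to A$ such that the augmented complex $\cdots\to P_1\to P_0\to A\to 0$ is exact (so $P_0\to A$ is an admissible epic). *)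

theory Defs
  imports "HOL-Algebra.Exact_Sequence"
begin

text \<open>
  A preadditive category as a record: objects and arrows are sets in the types \<open>'o\<close> and \<open>'m\<close>.
  \<open>Comp C g f\<close> is the composite of \<open>f\<close> followed by \<open>g\<close>; \<open>Add\<close> is only meaningful for
  parallel arrows, and \<open>Zero C a b\<close> is the zero arrow from \<open>a\<close> to \<open>b\<close>.
\<close>

record ('o, 'm) preadd =
  Obj :: "'o set"
  Arr :: "'m set"
  Dom :: "'m \<Rightarrow> 'o"
  Cod :: "'m \<Rightarrow> 'o"
  Id :: "'o \<Rightarrow> 'm"
  Comp :: "'m \<Rightarrow> 'm \<Rightarrow> 'm" (infixl \<open>\<cdot>\<index>\<close> 70)
  Add :: "'m \<Rightarrow> 'm \<Rightarrow> 'm" (infixl \<open>\<boxplus>\<index>\<close> 65)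
  Zero :: "'o \<Rightarrow> 'o \<Rightarrow> 'm"

definition homset :: "('o, 'm, 'z) preadd_scheme \<Rightarrow> 'o \<Rightarrow> 'o \<Rightarrow> 'm set" where
  "homset C a b = {f \<in> Arr C. Dom C f = a \<and> Cod C f = b}"

definition hom_group :: "('o, 'm, 'z) preadd_scheme \<Rightarrow> 'o \<Rightarrow> 'o \<Rightarrow> 'm monoid" where
  "hom_group C a b = \<lparr>carrier = homset C a b, monoid.mult = Add C, one = Zero C a b\<rparr>"

locale category =
  fixes C :: "('o, 'm, 'z) preadd_scheme" (structure)
  assumes dom_closed: "f \<in> Arr C \<Longrightarrow> Dom C f \<in> Obj C"
    and cod_closed: "f \<in> Arr C \<Longrightarrow> Cod C f \<in> Obj C"
    and id_in_hom: "a \<in> Obj C \<Longrightarrow> Id C a \<in> homset C a a"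
    and comp_in_hom: "\<lbrakk>f \<in> homset C a b; g \<in> homset C b c\<rbrakk> \<Longrightarrow> g \<cdot> f \<in> homset C a c"
    and comp_id_right: "f \<in> homset C a b \<Longrightarrow> f \<cdot> Id C a = f"
    and comp_id_left: "f \<in> homset C a b \<Longrightarrow> Id C b \<cdot> f = f"
    and comp_assoc: "\<lbrakk>f \<in> homset C a b; g \<in> homset C b c; h \<in> homset C c d\<rbrakk>
          \<Longrightarrow> h \<cdot> (g \<cdot> f) = (h \<cdot> g) \<cdot> f"

locale preadditive_category = category C for C :: "('o, 'm, 'z) preadd_scheme" (structure) +
  assumes hom_comm_group: "\<lbrakk>a \<in> Obj C; b \<in> Obj C\<rbrakk> \<Longrightarrow> comm_group (hom_group C a b)"
    and comp_add_left: "\<lbrakk>f \<in> homset C a b; g \<in> homset C b c; h \<in> homset C b c\<rbrakk>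
          \<Longrightarrow> (g \<boxplus> h) \<cdot> f = (g \<cdot> f) \<boxplus> (h \<cdot> f)"
    and comp_add_right: "\<lbrakk>f \<in> homset C a b; g \<in> homset C a b; h \<in> homset C b c\<rbrakk>
          \<Longrightarrow> h \<cdot> (f \<boxplus> g) = (h \<cdot> f) \<boxplus> (h \<cdot> g)"

definition is_zero_object :: "('o, 'm, 'z) preadd_scheme \<Rightarrow> 'o \<Rightarrow> bool" where
  "is_zero_object C z \<longleftrightarrow> z \<in> Obj C \<and>
     (\<forall>a \<in> Obj C. (\<exists>!f. f \<in> homset C z a) \<and> (\<exists>!f. f \<in> homset C a z))"

text \<open>
  \<open>is_direct_sum C a b s j1 j2 q1 q2\<close>: the object \<open>s\<close> is \<open>a \<oplus> b\<close> with injections \<open>j1\<close>, \<open>j2\<close>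
  and projections \<open>q1\<close>, \<open>q2\<close>.  In matrix notation \<open>j1\<close> is the column \<open>(1, 0)\<close> and \<open>q2\<close> is
  the row \<open>(0, 1)\<close>.
\<close>

definition is_direct_sum ::
  "('o, 'm, 'z) preadd_scheme \<Rightarrow> 'o \<Rightarrow> 'o \<Rightarrow> 'o \<Rightarrow> 'm \<Rightarrow> 'm \<Rightarrow> 'm \<Rightarrow> 'm \<Rightarrow> bool" where
  "is_direct_sum C a b s j1 j2 q1 q2 \<longleftrightarrow>
     a \<in> Obj C \<and> b \<in> Obj C \<and> s \<in> Obj C \<and>
     j1 \<in> homset C a s \<and> j2 \<in> homset C b s \<and> q1 \<in> homset C s a \<and> q2 \<in> homset C s b \<and>
     q1 \<cdot>\<^bsub>C\<^esub> j1 = Id C a \<and> q2 \<cdot>\<^bsub>C\<^esub> j2 = Id C b \<and>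
     q2 \<cdot>\<^bsub>C\<^esub> j1 = Zero C a b \<and> q1 \<cdot>\<^bsub>C\<^esub> j2 = Zero C b a \<and>
     (j1 \<cdot>\<^bsub>C\<^esub> q1) \<boxplus>\<^bsub>C\<^esub> (j2 \<cdot>\<^bsub>C\<^esub> q2) = Id C s"

locale additive_category = preadditive_category C for C :: "('o, 'm, 'z) preadd_scheme" (structure) +
  assumes zero_object_exists: "\<exists>z. is_zero_object C z"
    and direct_sum_exists: "\<lbrakk>a \<in> Obj C; b \<in> Obj C\<rbrakk>
          \<Longrightarrow> \<exists>s j1 j2 q1 q2. is_direct_sum C a b s j1 j2 q1 q2"

definition is_iso :: "('o, 'm, 'z) preadd_scheme \<Rightarrow> 'm \<Rightarrow> bool" where
  "is_iso C f \<longleftrightarrow> f \<in> Arr C \<and>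
     (\<exists>g \<in> homset C (Cod C f) (Dom C f). g \<cdot>\<^bsub>C\<^esub> f = Id C (Dom C f) \<and> f \<cdot>\<^bsub>C\<^esub> g = Id C (Cod C f))"

definition is_kernel :: "('o, 'm, 'z) preadd_scheme \<Rightarrow> 'm \<Rightarrow> 'm \<Rightarrow> bool" where
  "is_kernel C i p \<longleftrightarrow> i \<in> Arr C \<and> p \<in> Arr C \<and> Cod C i = Dom C p \<and>
     p \<cdot>\<^bsub>C\<^esub> i = Zero C (Dom C i) (Cod C p) \<and>
     (\<forall>x \<in> Obj C. \<forall>f \<in> homset C x (Dom C p). p \<cdot>\<^bsub>C\<^esub> f = Zero C x (Cod C p) \<longrightarrow>
        (\<exists>!g. g \<in> homset C x (Dom C i) \<and> i \<cdot>\<^bsub>C\<^esub> g = f))"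

definition is_cokernel :: "('o, 'm, 'z) preadd_scheme \<Rightarrow> 'm \<Rightarrow> 'm \<Rightarrow> bool" where
  "is_cokernel C p i \<longleftrightarrow> i \<in> Arr C \<and> p \<in> Arr C \<and> Cod C i = Dom C p \<and>
     p \<cdot>\<^bsub>C\<^esub> i = Zero C (Dom C i) (Cod C p) \<and>
     (\<forall>x \<in> Obj C. \<forall>f \<in> homset C (Cod C i) x. f \<cdot>\<^bsub>C\<^esub> i = Zero C (Dom C i) x \<longrightarrow>
        (\<exists>!g. g \<in> homset C (Cod C p) x \<and> g \<cdot>\<^bsub>C\<^esub> p = f))"

definition kernel_cokernel_pair :: "('o, 'm, 'z) preadd_scheme \<Rightarrow> 'm \<Rightarrow> 'm \<Rightarrow> bool" where
  "kernel_cokernel_pair C i p \<longleftrightarrow> is_kernel C i p \<and> is_cokernel C p i"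

text \<open>
  \<open>is_pushout C f g f' g'\<close>: the square \<open>f' \<cdot> f = g' \<cdot> g\<close> is a push-out of \<open>f\<close> and \<open>g\<close>, so
  \<open>g'\<close> is the push-out of \<open>f\<close> along \<open>g\<close>.  Dually, \<open>is_pullback C f g f' g'\<close>: the square
  \<open>f \<cdot> f' = g \<cdot> g'\<close> is a pull-back of \<open>f\<close> and \<open>g\<close>, and \<open>g'\<close> is the pull-back of \<open>f\<close> along \<open>g\<close>.
\<close>

definition is_pushout :: "('o, 'm, 'z) preadd_scheme \<Rightarrow> 'm \<Rightarrow> 'm \<Rightarrow> 'm \<Rightarrow> 'm \<Rightarrow> bool" where
  "is_pushout C f g f' g' \<longleftrightarrow>
     f \<in> Arr C \<and> g \<in> Arr C \<and> f' \<in> Arr C \<and> g' \<in> Arr C \<and>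
     Dom C f = Dom C g \<and> Dom C f' = Cod C f \<and> Dom C g' = Cod C g \<and> Cod C f' = Cod C g' \<and>
     f' \<cdot>\<^bsub>C\<^esub> f = g' \<cdot>\<^bsub>C\<^esub> g \<and>
     (\<forall>x \<in> Obj C. \<forall>u \<in> homset C (Cod C f) x. \<forall>v \<in> homset C (Cod C g) x.
        u \<cdot>\<^bsub>C\<^esub> f = v \<cdot>\<^bsub>C\<^esub> g \<longrightarrow>
        (\<exists>!w. w \<in> homset C (Cod C f') x \<and> w \<cdot>\<^bsub>C\<^esub> f' = u \<and> w \<cdot>\<^bsub>C\<^esub> g' = v))"

definition is_pullback :: "('o, 'm, 'z) preadd_scheme \<Rightarrow> 'm \<Rightarrow> 'm \<Rightarrow> 'm \<Rightarrow> 'm \<Rightarrow> bool" where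
  "is_pullback C f g f' g' \<longleftrightarrow>
     f \<in> Arr C \<and> g \<in> Arr C \<and> f' \<in> Arr C \<and> g' \<in> Arr C \<and>
     Cod C f = Cod C g \<and> Cod C f' = Dom C f \<and> Cod C g' = Dom C g \<and> Dom C f' = Dom C g' \<and>
     f \<cdot>\<^bsub>C\<^esub> f' = g \<cdot>\<^bsub>C\<^esub> g' \<and>
     (\<forall>x \<in> Obj C. \<forall>u \<in> homset C x (Dom C f). \<forall>v \<in> homset C x (Dom C g).
        f \<cdot>\<^bsub>C\<^esub> u = g \<cdot>\<^bsub>C\<^esub> v \<longrightarrow>
        (\<exists>!w. w \<in> homset C x (Dom C f') \<and> f' \<cdot>\<^bsub>C\<^esub> w = u \<and> g' \<cdot>\<^bsub>C\<^esub> w = v))"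

definition adm_monic :: "('m \<times> 'm) set \<Rightarrow> 'm \<Rightarrow> bool" where
  "adm_monic E i \<longleftrightarrow> (\<exists>p. (i, p) \<in> E)"

definition adm_epic :: "('m \<times> 'm) set \<Rightarrow> 'm \<Rightarrow> bool" where
  "adm_epic E p \<longleftrightarrow> (\<exists>i. (i, p) \<in> E)"

locale exact_category = additive_category C for C :: "('o, 'm, 'z) preadd_scheme" (structure) +
  fixes E :: "('m \<times> 'm) set"
  assumes E_kernel_cokernel: "(i, p) \<in> E \<Longrightarrow> kernel_cokernel_pair C i p"
    and E_iso_closed:
      "\<lbrakk>(i, p) \<in> E; j \<in> Arr C; q \<in> Arr C; Cod C j = Dom C q;
        is_iso C a'; a' \<in> homset C (Dom C i) (Dom C j);
        is_iso C a; a \<in> homset C (Cod C i) (Cod C j);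
        is_iso C a''; a'' \<in> homset C (Cod C p) (Cod C q);
        a \<cdot> i = j \<cdot> a'; a'' \<cdot> p = q \<cdot> a\<rbrakk> \<Longrightarrow> (j, q) \<in> E"
    and id_adm_monic: "x \<in> Obj C \<Longrightarrow> adm_monic E (Id C x)"
    and id_adm_epic: "x \<in> Obj C \<Longrightarrow> adm_epic E (Id C x)"
    and comp_adm_monic: "\<lbrakk>adm_monic E f; adm_monic E g; Cod C f = Dom C g\<rbrakk> \<Longrightarrow> adm_monic E (g \<cdot> f)"
    and comp_adm_epic: "\<lbrakk>adm_epic E f; adm_epic E g; Cod C f = Dom C g\<rbrakk> \<Longrightarrow> adm_epic E (g \<cdot> f)"
    and pushout_adm_monic: "\<lbrakk>adm_monic E f; g \<in> Arr C; Dom C g = Dom C f\<rbrakk>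
          \<Longrightarrow> \<exists>f' g'. is_pushout C f g f' g' \<and> adm_monic E g'"
    and pullback_adm_epic: "\<lbrakk>adm_epic E f; g \<in> Arr C; Cod C g = Cod C f\<rbrakk>
          \<Longrightarrow> \<exists>f' g'. is_pullback C f g f' g' \<and> adm_epic E g'"

text \<open>
  The library's \<^const>\<open>short_exact_sequence\<close> lists the groups from right to left: below it is
  \<open>0 \<rightarrow> Hom(P, A') \<rightarrow> Hom(P, A) \<rightarrow> Hom(P, A'') \<rightarrow> 0\<close> with maps post-composition by \<open>i\<close> and \<open>p\<close>.
\<close>

definition projective :: "('o, 'm, 'z) preadd_scheme \<Rightarrow> ('m \<times> 'm) set \<Rightarrow> 'o \<Rightarrow> bool" where
  "projective C E P \<longleftrightarrow> P \<in> Obj C \<and>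
     (\<forall>(i, p) \<in> E. short_exact_sequence
        (hom_group C P (Cod C p)) (hom_group C P (Dom C p)) (hom_group C P (Dom C i))
        (\<lambda>f. p \<cdot>\<^bsub>C\<^esub> f) (\<lambda>f. i \<cdot>\<^bsub>C\<^esub> f))"

text \<open>Complexes are indexed by the integers, with \<open>d n\<close> going from \<open>X n\<close> to \<open>X (n - 1)\<close>.\<close>

definition chain_complex ::
  "('o, 'm, 'z) preadd_scheme \<Rightarrow> (int \<Rightarrow> 'o) \<Rightarrow> (int \<Rightarrow> 'm) \<Rightarrow> bool" where
  "chain_complex C X d \<longleftrightarrow>
     (\<forall>n. X n \<in> Obj C \<and> d n \<in> homset C (X n) (X (n - 1)) \<and>
          d (n - 1) \<cdot>\<^bsub>C\<^esub> d n = Zero C (X n) (X (n - 2)))"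

definition exact_complex ::
  "('o, 'm, 'z) preadd_scheme \<Rightarrow> ('m \<times> 'm) set \<Rightarrow> (int \<Rightarrow> 'o) \<Rightarrow> (int \<Rightarrow> 'm) \<Rightarrow> bool" where
  "exact_complex C E X d \<longleftrightarrow> chain_complex C X d \<and>
     (\<exists>Z e m. \<forall>n. e n \<in> homset C (X n) (Z (n - 1)) \<and> m n \<in> homset C (Z n) (X n) \<and>
        d n = m (n - 1) \<cdot>\<^bsub>C\<^esub> e n \<and> (m n, e n) \<in> E)"

text \<open>
  The augmented complex \<open>\<dots> \<rightarrow> P 1 \<rightarrow> P 0 \<rightarrow> A \<rightarrow> 0 \<rightarrow> \<dots>\<close>, with \<open>A\<close> in degree \<open>-1\<close>.  It is only
  used when \<open>P n\<close> is a zero object for \<open>n < 0\<close>, and those zero objects serve as its entries in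
  degrees below \<open>-1\<close>.
\<close>

definition aug_obj :: "(int \<Rightarrow> 'o) \<Rightarrow> 'o \<Rightarrow> int \<Rightarrow> 'o" where
  "aug_obj P A n = (if n = -1 then A else P n)"

definition aug_diff ::
  "('o, 'm, 'z) preadd_scheme \<Rightarrow> (int \<Rightarrow> 'o) \<Rightarrow> (int \<Rightarrow> 'm) \<Rightarrow> 'm \<Rightarrow> 'o \<Rightarrow> int \<Rightarrow> 'm" where
  "aug_diff C P d eps A n =
     (if n = 0 then eps else if n = -1 then Zero C A (P (-2)) else d n)"

definition projective_resolution ::
  "('o, 'm, 'z) preadd_scheme \<Rightarrow> ('m \<times> 'm) set \<Rightarrow> (int \<Rightarrow> 'o) \<Rightarrow> (int \<Rightarrow> 'm) \<Rightarrow> 'm \<Rightarrow> 'o \<Rightarrow> bool"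
  where
  "projective_resolution C E P d eps A \<longleftrightarrow>
     chain_complex C P d \<and> (\<forall>n. projective C E (P n)) \<and> (\<forall>n < 0. is_zero_object C (P n)) \<and>
     A \<in> Obj C \<and> eps \<in> homset C (P 0) A \<and>
     exact_complex C E (aug_obj P A) (aug_diff C P d eps A)"

end

theory Submission
  imports Defs
begin

text \<open>
  The step from short exact sequences \<open>K' \<rightarrow> P' \<rightarrow> A'\<close> and \<open>K'' \<rightarrow> P'' \<rightarrow> A''\<close> to
  \<open>K \<rightarrow> P' \<oplus> P'' \<rightarrow> A\<close> uses pull-backs only.  Let \<open>l : P'' \<rightarrow> A\<close> lift \<open>e''\<close> along \<open>p\<close>.  Then
  \<open>[i e', l]\<close> factors as \<open>r = e' \<oplus> 1 : P' \<oplus> P'' \<rightarrow> A' \<oplus> P''\<close> followed by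
  \<open>[i, l] : A' \<oplus> P'' \<rightarrow> A\<close>.  The first is the pull-back of \<open>e'\<close> along the projection to \<open>A'\<close>, the
  second the pull-back of \<open>e''\<close> along \<open>p\<close>, so the composite is an admissible epic.  The kernel of
  \<open>[i, l]\<close> is an arrow \<open>K'' \<rightarrow> A' \<oplus> P''\<close>, and pulling \<open>r\<close> back along it gives the admissible epic
  \<open>K \<rightarrow> K''\<close>, whose kernel is \<open>K'\<close>.  Iterating the step with \<open>K' \<rightarrow> K \<rightarrow> K''\<close> in place of
  \<open>A' \<rightarrow> A \<rightarrow> A''\<close> produces the resolution.
\<close>

section \<open>Arrows, kernels, pull-backs and zero objects in a category\<close>

context category
begin

lemma comp_closed [simp]:
  "\<lbrakk>f \<in> Arr C; g \<in> Arr C; Cod C f = Dom C g\<rbrakk> \<Longrightarrow> g \<cdot> f \<in> Arr C"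
  "\<lbrakk>f \<in> Arr C; g \<in> Arr C; Cod C f = Dom C g\<rbrakk> \<Longrightarrow> Dom C (g \<cdot> f) = Dom C f"
  "\<lbrakk>f \<in> Arr C; g \<in> Arr C; Cod C f = Dom C g\<rbrakk> \<Longrightarrow> Cod C (g \<cdot> f) = Cod C g"
  using comp_in_hom[of f "Dom C f" "Cod C f" g "Cod C g"] by (auto simp: homset_def)

lemma id_closed [simp]:
  "a \<in> Obj C \<Longrightarrow> Id C a \<in> Arr C"
  "a \<in> Obj C \<Longrightarrow> Dom C (Id C a) = a"
  "a \<in> Obj C \<Longrightarrow> Cod C (Id C a) = a"
  using id_in_hom[of a] by (auto simp: homset_def)

lemma comp_id [simp]:
  "\<lbrakk>f \<in> Arr C; Dom C f = a\<rbrakk> \<Longrightarrow> f \<cdot> Id C a = f"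
  "\<lbrakk>f \<in> Arr C; Cod C f = b\<rbrakk> \<Longrightarrow> Id C b \<cdot> f = f"
  using comp_id_right[of f a] comp_id_left[of f _ b] by (auto simp: homset_def)

lemma comp_assoc_right [simp]:
  "\<lbrakk>f \<in> Arr C; g \<in> Arr C; h \<in> Arr C; Cod C f = Dom C g; Cod C g = Dom C h\<rbrakk>
    \<Longrightarrow> (h \<cdot> g) \<cdot> f = h \<cdot> (g \<cdot> f)"
  using comp_assoc[of f "Dom C f" "Cod C f" g "Cod C g" h "Cod C h"] by (auto simp: homset_def)

text \<open>The simp set associates composites to the right, where the left side of an equation
  \<open>g \<cdot> f = h\<close> no longer matches inside \<open>g \<cdot> (f \<cdot> x)\<close>.
  This form restores such rewrites; many simplifications below feed it a commuting square or a
  vanishing composite.\<close>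

lemma comp_reduce:
  "\<lbrakk>g \<cdot> f = h; f \<in> Arr C; g \<in> Arr C; Cod C f = Dom C g; x \<in> Arr C; Cod C x = Dom C f\<rbrakk>
    \<Longrightarrow> g \<cdot> (f \<cdot> x) = h \<cdot> x"
  using comp_assoc_right[of x f g] by simp

lemma is_isoI:
  assumes "f \<in> homset C a b" "g \<in> homset C b a" "g \<cdot> f = Id C a" "f \<cdot> g = Id C b"
  shows "is_iso C f"
  using assms unfolding is_iso_def homset_def by auto

lemma is_iso_Id: "a \<in> Obj C \<Longrightarrow> is_iso C (Id C a)"
  by (rule is_isoI[of _ a a "Id C a"]) (auto simp: homset_def)

lemma in_homD:
  assumes "f \<in> homset C a b"
  shows "f \<in> Arr C" "Dom C f = a" "Cod C f = b"
  using assms by (auto simp: homset_def)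

lemma kernel_simps:
  assumes "is_kernel C i p"
  shows "i \<in> Arr C" "p \<in> Arr C" "Cod C i = Dom C p" "p \<cdot> i = Zero C (Dom C i) (Cod C p)"
  using assms by (simp_all add: is_kernel_def)

lemma kernel_lift:
  assumes "is_kernel C i p" "f \<in> Arr C" "Cod C f = Dom C p" "p \<cdot> f = Zero C (Dom C f) (Cod C p)"
  obtains g where "g \<in> homset C (Dom C f) (Dom C i)" "i \<cdot> g = f"
proof -
  have "f \<in> homset C (Dom C f) (Dom C p)" "Dom C f \<in> Obj C"
    using assms dom_closed by (auto simp: homset_def)
  then show thesis
    using assms that unfolding is_kernel_def by blast
qed

lemma pullback_ex1:
  assumes "is_pullback C f g f' g'" "u \<in> homset C x (Dom C f)" "v \<in> homset C x (Dom C g)" "f \<cdot> u = g \<cdot> v"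
  shows "\<exists>!w. w \<in> homset C x (Dom C f') \<and> f' \<cdot> w = u \<and> g' \<cdot> w = v"
proof -
  have "x \<in> Obj C"
    using assms(2) dom_closed by (auto simp: homset_def)
  then show ?thesis
    using assms unfolding is_pullback_def by blast
qed

text \<open>The legs of a pull-back are jointly monic, because both arrows mediate the same
  cone.\<close>

lemma pullback_ext:
  assumes pb: "is_pullback C f g f' g'" and "u \<in> homset C x (Dom C f')" "v \<in> homset C x (Dom C f')"
    and "f' \<cdot> u = f' \<cdot> v" "g' \<cdot> u = g' \<cdot> v"
  shows "u = v"
proof -
  have pb': "f \<in> Arr C" "g \<in> Arr C" "f' \<in> Arr C" "g' \<in> Arr C" "Cod C f' = Dom C f"
    "Cod C g' = Dom C g" "Dom C g' = Dom C f'" "f \<cdot> f' = g \<cdot> g'"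
    using pb by (simp_all add: is_pullback_def)
  then have "f' \<cdot> u \<in> homset C x (Dom C f)" "g' \<cdot> u \<in> homset C x (Dom C g)" "f \<cdot> (f' \<cdot> u) = g \<cdot> (g' \<cdot> u)"
    using in_homD[OF assms(2)] by (simp_all add: homset_def pb' comp_reduce[OF pb'(8)])
  from pullback_ex1[OF pb this] show ?thesis
    using assms by metis
qed

lemma zero_object_eq:
  assumes "is_zero_object C z" "f \<in> homset C a z" "g \<in> homset C a z"
  shows "f = g"
proof -
  have "a \<in> Obj C"
    using in_homD[OF assms(2)] dom_closed by auto
  then show ?thesis
    using assms unfolding is_zero_object_def by blast
qed

lemma zero_object_eq_dom:
  assumes "is_zero_object C z" "f \<in> homset C z a" "g \<in> homset C z a"
  shows "f = g"
proof -
  have "a \<in> Obj C"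
    using in_homD[OF assms(2)] cod_closed by auto
  then show ?thesis
    using assms unfolding is_zero_object_def by blast
qed

end

section \<open>Addition and zero arrows\<close>

context preadditive_category
begin

lemma zero_closed [simp]:
  assumes "a \<in> Obj C" "b \<in> Obj C"
  shows "Zero C a b \<in> Arr C" "Dom C (Zero C a b) = a" "Cod C (Zero C a b) = b"
proof -
  interpret G: comm_group "hom_group C a b" by (rule hom_comm_group[OF assms])
  show "Zero C a b \<in> Arr C" "Dom C (Zero C a b) = a" "Cod C (Zero C a b) = b"
    using G.one_closed by (auto simp: hom_group_def homset_def)
qed

lemma add_closed [simp]:
  assumes "f \<in> Arr C" "g \<in> Arr C" "Dom C f = Dom C g" "Cod C f = Cod C g"
  shows "f \<boxplus> g \<in> Arr C" "Dom C (f \<boxplus> g) = Dom C g" "Cod C (f \<boxplus> g) = Cod C g"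
proof -
  interpret G: comm_group "hom_group C (Dom C g) (Cod C g)"
    by (rule hom_comm_group) (use assms dom_closed cod_closed in auto)
  show "f \<boxplus> g \<in> Arr C" "Dom C (f \<boxplus> g) = Dom C g" "Cod C (f \<boxplus> g) = Cod C g"
    using G.m_closed[of f g] assms by (auto simp: hom_group_def homset_def)
qed

lemma add_zero [simp]:
  assumes "f \<in> Arr C" "Dom C f = a" "Cod C f = b"
  shows "f \<boxplus> Zero C a b = f" "Zero C a b \<boxplus> f = f"
proof -
  interpret G: comm_group "hom_group C a b"
    by (rule hom_comm_group) (use assms dom_closed cod_closed in auto)
  show "f \<boxplus> Zero C a b = f" "Zero C a b \<boxplus> f = f"
    using G.r_one[of f] G.l_one[of f] assms by (auto simp: hom_group_def homset_def)
qed

lemma add_right_cancel: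
  assumes "f \<boxplus> h = g \<boxplus> h" "f \<in> homset C a b" "g \<in> homset C a b" "h \<in> homset C a b"
  shows "f = g"
proof -
  interpret G: comm_group "hom_group C a b"
    by (rule hom_comm_group) (use assms dom_closed cod_closed in \<open>auto simp: homset_def\<close>)
  show ?thesis
    using G.right_cancel[of h f g] assms by (simp add: hom_group_def)
qed

text \<open>The record carries no negation of arrows, so a difference is formed with the inverse of
  the hom group and only its existence is exported.\<close>

lemma obtain_diff:
  assumes "f \<in> homset C a b" "g \<in> homset C a b"
  obtains h where "h \<in> homset C a b" "h \<boxplus> g = f"
proof -
  interpret G: comm_group "hom_group C a b"
    by (rule hom_comm_group) (use assms dom_closed cod_closed in \<open>auto simp: homset_def\<close>)
  have "(f \<otimes>\<^bsub>hom_group C a b\<^esub> inv\<^bsub>hom_group C a b\<^esub> g) \<otimes>\<^bsub>hom_group C a b\<^esub> g = f"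
    using assms G.inv_closed[of g] G.l_inv[of g] G.r_one[of f] G.m_assoc[of f _ g] by (simp add: hom_group_def)
  then show thesis
    using that[of "f \<otimes>\<^bsub>hom_group C a b\<^esub> inv\<^bsub>hom_group C a b\<^esub> g"] G.inv_closed[of g] G.m_closed assms
    by (simp add: hom_group_def)
qed

lemma comp_add [simp]:
  "\<lbrakk>f \<in> Arr C; g \<in> Arr C; h \<in> Arr C; Dom C g = Dom C h; Cod C g = Cod C h; Cod C f = Dom C h\<rbrakk>
    \<Longrightarrow> (g \<boxplus> h) \<cdot> f = (g \<cdot> f) \<boxplus> (h \<cdot> f)"
  "\<lbrakk>f \<in> Arr C; g \<in> Arr C; h \<in> Arr C; Dom C f = Dom C g; Cod C f = Cod C g; Cod C g = Dom C h\<rbrakk>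
    \<Longrightarrow> h \<cdot> (f \<boxplus> g) = (h \<cdot> f) \<boxplus> (h \<cdot> g)"
  using comp_add_left[of f "Dom C f" "Dom C g" g "Cod C g" h]
    comp_add_right[of f "Dom C f" "Cod C g" g h "Cod C h"]
  by (auto simp: homset_def)

text \<open>This is derived from bilinearity: the composite with zero equals its own double, and
  cancellation makes it zero.\<close>

lemma comp_zero_right [simp]:
  assumes "g \<in> Arr C" "a \<in> Obj C" "b = Dom C g"
  shows "g \<cdot> Zero C a b = Zero C a (Cod C g)"
proof (rule add_right_cancel)
  have [simp]: "b \<in> Obj C" "Cod C g \<in> Obj C" "Dom C g \<in> Obj C" using assms dom_closed cod_closed by auto
  \<comment> \<open>\<open>add_zero\<close> is switched off so that distributivity acts before the
    sum of two zero arrows collapses.\<close>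
  have "g \<cdot> Zero C a b \<boxplus> g \<cdot> Zero C a b = g \<cdot> (Zero C a b \<boxplus> Zero C a b)"
    using assms by (simp del: add_zero)
  then show "g \<cdot> Zero C a b \<boxplus> g \<cdot> Zero C a b = Zero C a (Cod C g) \<boxplus> g \<cdot> Zero C a b"
    using assms by simp
qed (use assms dom_closed cod_closed in \<open>auto simp: homset_def\<close>)

lemma comp_zero_left [simp]:
  assumes "f \<in> Arr C" "c \<in> Obj C" "b = Cod C f"
  shows "Zero C b c \<cdot> f = Zero C (Dom C f) c"
proof (rule add_right_cancel)
  have [simp]: "b \<in> Obj C" "Cod C f \<in> Obj C" "Dom C f \<in> Obj C" using assms dom_closed cod_closed by auto
  have "Zero C b c \<cdot> f \<boxplus> Zero C b c \<cdot> f = (Zero C b c \<boxplus> Zero C b c) \<cdot> f"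
    using assms by (simp del: add_zero)
  then show "Zero C b c \<cdot> f \<boxplus> Zero C b c \<cdot> f = Zero C (Dom C f) c \<boxplus> Zero C b c \<cdot> f"
    using assms by simp
qed (use assms dom_closed cod_closed in \<open>auto simp: homset_def\<close>)

text \<open>The arrow \<open>i \<cdot> f\<close> is killed by \<open>p\<close>, so it factors
  uniquely through \<open>i\<close>; both \<open>f\<close> and \<open>g\<close> are such
  factorisations.\<close>

lemma kernel_monic:
  assumes "is_kernel C i p" "f \<in> homset C x (Dom C i)" "g \<in> homset C x (Dom C i)" "i \<cdot> f = i \<cdot> g"
  shows "f = g"
proof -
  note a = kernel_simps[OF assms(1)]
  have f: "f \<in> Arr C" "Dom C f = x" "Cod C f = Dom C i"
    using assms by (auto simp: homset_def)
  have [simp]: "x \<in> Obj C" "Cod C p \<in> Obj C"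
    using a f dom_closed cod_closed by auto
  have "p \<cdot> (i \<cdot> f) = Zero C x (Cod C p)"
    using a f by (simp add: comp_reduce[OF a(4)])
  moreover have "i \<cdot> f \<in> homset C x (Dom C p)"
    using a f by (simp add: homset_def)
  ultimately have "\<exists>!h. h \<in> homset C x (Dom C i) \<and> i \<cdot> h = i \<cdot> f"
    using assms(1) unfolding is_kernel_def by simp
  then show ?thesis
    using assms(2-4) by metis
qed

section \<open>Direct sums described by injections and projections\<close>

context
  fixes a b s j1 j2 q1 q2
  assumes ds: "is_direct_sum C a b s j1 j2 q1 q2"
begin

lemma direct_sum_simps:
  "a \<in> Obj C" "b \<in> Obj C" "s \<in> Obj C"
  "j1 \<in> Arr C" "Dom C j1 = a" "Cod C j1 = s" "j2 \<in> Arr C" "Dom C j2 = b" "Cod C j2 = s"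
  "q1 \<in> Arr C" "Dom C q1 = s" "Cod C q1 = a" "q2 \<in> Arr C" "Dom C q2 = s" "Cod C q2 = b"
  "q1 \<cdot> j1 = Id C a" "q2 \<cdot> j2 = Id C b" "q2 \<cdot> j1 = Zero C a b" "q1 \<cdot> j2 = Zero C b a"
  using ds by (auto simp: is_direct_sum_def homset_def)

lemma direct_sum_comp_simps:
  assumes "x \<in> Arr C"
  shows "Cod C x = a \<Longrightarrow> q1 \<cdot> (j1 \<cdot> x) = x" "Cod C x = b \<Longrightarrow> q2 \<cdot> (j2 \<cdot> x) = x"
    "Cod C x = a \<Longrightarrow> q2 \<cdot> (j1 \<cdot> x) = Zero C (Dom C x) b"
    "Cod C x = b \<Longrightarrow> q1 \<cdot> (j2 \<cdot> x) = Zero C (Dom C x) a"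
  using assms dom_closed[OF assms]
  by (simp_all add: direct_sum_simps direct_sum_simps(16-19)[THEN comp_reduce])

text \<open>Expanding the identity of \<open>s\<close> as
  \<open>j1 \<cdot> q1 \<boxplus> j2 \<cdot> q2\<close> rebuilds an arrow into \<open>s\<close> from
  its two components.\<close>

lemma direct_sum_ext:
  assumes "u \<in> homset C x s" "v \<in> homset C x s" "q1 \<cdot> u = q1 \<cdot> v" "q2 \<cdot> u = q2 \<cdot> v"
  shows "u = v"
proof -
  have "w = j1 \<cdot> (q1 \<cdot> w) \<boxplus> j2 \<cdot> (q2 \<cdot> w)" if "w \<in> homset C x s" for w
  proof -
    have "w = (j1 \<cdot> q1 \<boxplus> j2 \<cdot> q2) \<cdot> w"
      using ds that by (simp add: is_direct_sum_def homset_def)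
    then show ?thesis
      using that direct_sum_simps by (simp add: homset_def)
  qed
  then show ?thesis
    using assms by metis
qed

lemma direct_sum_ext_dom:
  assumes "u \<in> homset C s x" "v \<in> homset C s x" "u \<cdot> j1 = v \<cdot> j1" "u \<cdot> j2 = v \<cdot> j2"
  shows "u = v"
proof -
  have "w = (w \<cdot> j1) \<cdot> q1 \<boxplus> (w \<cdot> j2) \<cdot> q2" if "w \<in> homset C s x" for w
  proof -
    have "w = w \<cdot> (j1 \<cdot> q1 \<boxplus> j2 \<cdot> q2)"
      using ds that by (simp add: is_direct_sum_def homset_def)
    then show ?thesis
      using that direct_sum_simps by (simp add: homset_def)
  qed
  then show ?thesis
    using assms by metis
qed

end

end

section \<open>Closure properties of the class of short exact sequences\<close>

context exact_category
begin

lemma E_simps: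
  assumes "(i, p) \<in> E"
  shows "i \<in> Arr C" "p \<in> Arr C" "Cod C i = Dom C p" "p \<cdot> i = Zero C (Dom C i) (Cod C p)"
    "is_kernel C i p" "is_cokernel C p i"
proof -
  show ker: "is_kernel C i p" and "is_cokernel C p i"
    using E_kernel_cokernel[OF assms] by (simp_all add: kernel_cokernel_pair_def)
  show "i \<in> Arr C" "p \<in> Arr C" "Cod C i = Dom C p" "p \<cdot> i = Zero C (Dom C i) (Cod C p)"
    using kernel_simps[OF ker] by auto
qed

lemma E_iso_middle:
  assumes "(i, p) \<in> E" "is_iso C a" "a \<in> homset C (Dom C p) (Dom C q)" "q \<in> Arr C" "q \<cdot> a = p"
  shows "(a \<cdot> i, q) \<in> E"
proof -
  note i = E_simps[OF assms(1)]
  have a: "a \<in> Arr C" "Dom C a = Dom C p" "Cod C a = Dom C q"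
    using assms(3) by (auto simp: homset_def)
  have c: "Cod C p = Cod C q"
    using comp_closed(3)[of a q] a assms(4,5) by simp
  have o: "Dom C i \<in> Obj C" "Cod C q \<in> Obj C"
    using assms(4) i(1) dom_closed cod_closed by auto
  show ?thesis
    by (rule E_iso_closed[OF assms(1), of _ _ "Id C (Dom C i)" a "Id C (Cod C q)"])
      (simp_all add: homset_def is_iso_Id assms i(1-4) a c o)
qed

text \<open>Two kernels of \<open>p\<close> differ by a unique isomorphism, and \<open>E\<close> is
  closed under isomorphism. The axioms only say that an admissible epic has some kernel in
  \<open>E\<close>; this replaces it by a prescribed one.\<close>

lemma E_kernel:
  assumes "(i, p) \<in> E" "is_kernel C j p"
  shows "(j, p) \<in> E"
proof -
  note i = E_simps[OF assms(1)]
  have j: "j \<in> Arr C" "Cod C j = Dom C p" "p \<cdot> j = Zero C (Dom C j) (Cod C p)"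
    using kernel_simps[OF assms(2)] by auto
  have [simp]: "Dom C i \<in> Obj C" "Dom C j \<in> Obj C" "Dom C p \<in> Obj C" "Cod C p \<in> Obj C"
    using i j dom_closed cod_closed by auto
  obtain f where f: "f \<in> homset C (Dom C i) (Dom C j)" "j \<cdot> f = i"
    using kernel_lift[OF assms(2), of i] i by auto
  obtain g where g: "g \<in> homset C (Dom C j) (Dom C i)" "i \<cdot> g = j"
    using kernel_lift[OF i(5), of j] j by auto
  note T = in_homD[OF f(1)] in_homD[OF g(1)] i(1-3) j(1,2)
  have "g \<cdot> f = Id C (Dom C i)"
    by (rule kernel_monic[OF i(5)]) (simp_all add: homset_def T comp_reduce[OF g(2)] f(2))
  moreover have "f \<cdot> g = Id C (Dom C j)"
    by (rule kernel_monic[OF assms(2)]) (simp_all add: homset_def T comp_reduce[OF f(2)] g(2))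
  ultimately have "is_iso C f"
    using is_isoI f g by blast
  then show ?thesis
    by (intro E_iso_closed[OF assms(1), of _ _ f "Id C (Dom C p)" "Id C (Cod C p)"])
      (simp_all add: homset_def is_iso_Id T f(2))
qed

text \<open>The axiom provides one pull-back with an admissible leg. Any other pull-back of the same
  arrows is isomorphic to it over \<open>Dom C g\<close>, so explicitly constructed squares can be
  used as well.\<close>

lemma adm_epic_pullback:
  assumes "adm_epic E f" "is_pullback C f g f' g'"
  shows "adm_epic E g'"
proof -
  have t: "f' \<in> homset C (Dom C f') (Dom C f)" "g' \<in> homset C (Dom C f') (Dom C g)" "f \<cdot> f' = g \<cdot> g'"
    and g: "g \<in> Arr C" "Cod C g = Cod C f"
    using assms(2) by (auto simp: is_pullback_def homset_def)
  obtain f1 g1 where pb1: "is_pullback C f g f1 g1" and g1: "adm_epic E g1"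
    using pullback_adm_epic[OF assms(1) g] by auto
  have t1: "f1 \<in> homset C (Dom C f1) (Dom C f)" "g1 \<in> homset C (Dom C f1) (Dom C g)" "f \<cdot> f1 = g \<cdot> g1"
    using pb1 by (auto simp: is_pullback_def homset_def)
  obtain w where w: "w \<in> homset C (Dom C f1) (Dom C f')" "f' \<cdot> w = f1" "g' \<cdot> w = g1"
    using pullback_ex1[OF assms(2) t1] by blast
  obtain v where v: "v \<in> homset C (Dom C f') (Dom C f1)" "f1 \<cdot> v = f'" "g1 \<cdot> v = g'"
    using pullback_ex1[OF pb1 t] by blast
  have [simp]: "Dom C f' \<in> Obj C" "Dom C f1 \<in> Obj C"
    using t t1 dom_closed by (auto simp: homset_def)
  note T = in_homD[OF w(1)] in_homD[OF v(1)] in_homD(1,3)[OF t(1)] in_homD[OF t(2)]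
    in_homD(1,3)[OF t1(1)] in_homD[OF t1(2)]
  have 1: "w \<cdot> v = Id C (Dom C f')"
    by (rule pullback_ext[OF assms(2)])
      (simp_all add: homset_def T comp_reduce[OF w(2)] comp_reduce[OF w(3)] v(2,3))
  have 2: "v \<cdot> w = Id C (Dom C f1)"
    by (rule pullback_ext[OF pb1])
      (simp_all add: homset_def T comp_reduce[OF v(2)] comp_reduce[OF v(3)] w(2,3))
  have "is_iso C w"
    using is_isoI[OF w(1) v(1) 2 1] .
  moreover obtain i1 where i1: "(i1, g1) \<in> E"
    using g1 unfolding adm_epic_def by blast
  moreover have "w \<in> homset C (Dom C g1) (Dom C g')"
    using w(1) T by simp
  ultimately have "(w \<cdot> i1, g') \<in> E"
    by (intro E_iso_middle[OF i1]) (simp_all add: w(3) T)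
  then show ?thesis
    unfolding adm_epic_def by blast
qed

text \<open>Some \<open>p\<close> makes \<open>(Id C a, p)\<close> short exact, and
  \<open>p = p \<cdot> Id C a\<close> is zero. Since \<open>p\<close> is a cokernel, the identity
  and the zero arrow of \<open>Cod C p\<close> must agree, so \<open>Cod C p\<close> is isomorphic
  to \<open>z\<close>.\<close>

lemma Id_Zero_in_E:
  assumes "a \<in> Obj C" "is_zero_object C z"
  shows "(Id C a, Zero C a z) \<in> E"
proof -
  obtain p where p: "(Id C a, p) \<in> E"
    using id_adm_monic assms unfolding adm_monic_def by blast
  note P = E_simps[OF p]
  have [simp]: "a \<in> Obj C" "z \<in> Obj C" "Cod C p \<in> Obj C" "Dom C p = a"
    using assms P cod_closed by (auto simp: is_zero_object_def)
  have p0: "p = Zero C a (Cod C p)"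
    using P by simp
  have pp: "Id C (Cod C p) = Zero C (Cod C p) (Cod C p)"
  proof -
    have "\<exists>!g. g \<in> homset C (Cod C p) (Cod C p) \<and> g \<cdot> p = Zero C a (Cod C p)"
      using P(2,6) unfolding is_cokernel_def homset_def by simp
    moreover have "Zero C (Cod C p) (Cod C p) \<cdot> p = Zero C a (Cod C p)" "Id C (Cod C p) \<cdot> p = Zero C a (Cod C p)"
      using P(2) p0 by simp_all
    moreover have "Zero C (Cod C p) (Cod C p) \<in> homset C (Cod C p) (Cod C p)" "Id C (Cod C p) \<in> homset C (Cod C p) (Cod C p)"
      by (simp_all add: homset_def)
    ultimately show ?thesis
      by blast
  qed
  have zz: "Zero C z z = Id C z"
    by (rule zero_object_eq[OF assms(2)]) (auto simp: homset_def)
  have "is_iso C (Zero C (Cod C p) z)"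
    by (rule is_isoI[of _ "Cod C p" z "Zero C z (Cod C p)"])
      (simp_all add: homset_def zz pp)
  then show ?thesis
    by (intro E_iso_closed[OF p, of _ _ "Id C a" "Id C a" "Zero C (Cod C p) z"])
      (use P in \<open>auto simp: homset_def is_iso_Id\<close>)
qed

text \<open>The direct sum is the pull-back of \<open>a\<close> and \<open>b\<close> over a zero
  object. Hence \<open>q2\<close> is a pull-back of the admissible epic from \<open>a\<close> to
  zero, and \<open>j1\<close> is a kernel of it.\<close>

lemma direct_sum_in_E:
  assumes ds: "is_direct_sum C a b s j1 j2 q1 q2"
  shows "(j1, q2) \<in> E"
proof -
  note D = direct_sum_simps[OF ds] direct_sum_comp_simps[OF ds]
  obtain z where z: "is_zero_object C z"
    using zero_object_exists by blast
  then have [simp]: "z \<in> Obj C" by (simp add: is_zero_object_def)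
  have "is_pullback C (Zero C a z) (Zero C b z) q1 q2"
    unfolding is_pullback_def
  proof (intro conjI ballI impI)
    fix x u v
    assume x: "x \<in> Obj C" and u: "u \<in> homset C x (Dom C (Zero C a z))"
      and v: "v \<in> homset C x (Dom C (Zero C b z))"
    show "\<exists>!w. w \<in> homset C x (Dom C q1) \<and> q1 \<cdot> w = u \<and> q2 \<cdot> w = v"
    proof (rule ex1I[of _ "j1 \<cdot> u \<boxplus> j2 \<cdot> v"])
      show "j1 \<cdot> u \<boxplus> j2 \<cdot> v \<in> homset C x (Dom C q1) \<and>
          q1 \<cdot> (j1 \<cdot> u \<boxplus> j2 \<cdot> v) = u \<and> q2 \<cdot> (j1 \<cdot> u \<boxplus> j2 \<cdot> v) = v"
        using u v D by (auto simp: homset_def)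
      then show "w = j1 \<cdot> u \<boxplus> j2 \<cdot> v" if "w \<in> homset C x (Dom C q1) \<and> q1 \<cdot> w = u \<and> q2 \<cdot> w = v" for w
        using direct_sum_ext[OF ds, of w x] that D by simp
    qed
  qed (use D in auto)
  moreover have "adm_epic E (Zero C a z)"
    using Id_Zero_in_E z D unfolding adm_epic_def by blast
  ultimately obtain k where k: "(k, q2) \<in> E"
    using adm_epic_pullback unfolding adm_epic_def by blast
  have "is_kernel C j1 q2"
    unfolding is_kernel_def
  proof (intro conjI ballI impI)
    fix x f
    assume f: "f \<in> homset C x (Dom C q2)" "q2 \<cdot> f = Zero C x (Cod C q2)" and x: "x \<in> Obj C"
    have "j1 \<cdot> (q1 \<cdot> f) = f"
      by (rule direct_sum_ext[OF ds, of _ x]) (use f D x in \<open>auto simp: homset_def\<close>)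
    moreover have "g = q1 \<cdot> f" if "g \<in> homset C x (Dom C j1)" "j1 \<cdot> g = f" for g
      using that D by (auto simp: homset_def)
    ultimately show "\<exists>!g. g \<in> homset C x (Dom C j1) \<and> j1 \<cdot> g = f"
      using f D by (intro ex1I[of _ "q1 \<cdot> f"]) (auto simp: homset_def)
  qed (use D in auto)
  then show ?thesis
    using E_kernel k by blast
qed

section \<open>Pull-back squares built from direct sums, and admissible epics into them\<close>

text \<open>If \<open>e \<cdot> u = p \<cdot> v\<close>, then the difference \<open>h\<close> of
  \<open>v\<close> and \<open>l \<cdot> u\<close> is killed by \<open>p\<close> and so equals
  \<open>i \<cdot> w\<close>; the arrow with components \<open>w\<close> and \<open>u\<close> is the
  mediating one.\<close>

lemma lift_pullback:
  assumes ip: "(i, p) \<in> E" "i \<in> homset C A' A" "p \<in> homset C A A''"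
    and l: "l \<in> homset C Q A" "p \<cdot> l = e"
    and ds: "is_direct_sum C A' Q T t1 t2 u1 u2"
  shows "is_pullback C e p u2 (i \<cdot> u1 \<boxplus> l \<cdot> u2)"
proof -
  note i = in_homD[OF ip(2)] and p = in_homD[OF ip(3)] and ker = E_simps(5)[OF ip(1)]
  note D = direct_sum_simps[OF ds] direct_sum_comp_simps[OF ds]
  have O: "A' \<in> Obj C" "A'' \<in> Obj C" "A \<in> Obj C"
    using i p dom_closed cod_closed by auto
  have pi: "p \<cdot> i = Zero C A' A''"
    using E_simps(4)[OF ip(1)] by (simp add: i p)
  have e: "e \<in> Arr C" "Dom C e = Q" "Cod C e = A''"
    using in_homD[OF l(1)] p by (auto simp: l(2)[symmetric])
  note S = i p D O e in_homD[OF l(1)]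
  show ?thesis
    unfolding is_pullback_def
  proof (intro conjI ballI impI)
    fix x u v
    assume x: "x \<in> Obj C" and "u \<in> homset C x (Dom C e)" and "v \<in> homset C x (Dom C p)"
      and uv: "e \<cdot> u = p \<cdot> v"
    then have u: "u \<in> homset C x Q" and v: "v \<in> homset C x A"
      by (simp_all add: S)
    note U = in_homD[OF u] in_homD[OF v]
    have "l \<cdot> u \<in> homset C x A"
      by (simp add: homset_def S U)
    then obtain h where h: "h \<in> homset C x A" "h \<boxplus> l \<cdot> u = v"
      using obtain_diff[OF v] by blast
    note H = in_homD[OF h(1)]
    have "p \<cdot> h = Zero C x A''"
    proof (rule add_right_cancel)
      have "p \<cdot> (h \<boxplus> l \<cdot> u) = p \<cdot> v"
        by (simp add: h)
      then show "p \<cdot> h \<boxplus> e \<cdot> u = Zero C x A'' \<boxplus> e \<cdot> u"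
        by (simp add: S U H x comp_reduce[OF l(2)] uv)
    qed (simp_all add: homset_def S U H x)
    then obtain w where "w \<in> homset C (Dom C h) (Dom C i)" and iw: "i \<cdot> w = h"
      using kernel_lift[OF ker, of h] by (auto simp: S H)
    then have w: "w \<in> homset C x A'"
      by (simp add: S H)
    note W = in_homD[OF w]
    show "\<exists>!y. y \<in> homset C x (Dom C u2) \<and> u2 \<cdot> y = u \<and> (i \<cdot> u1 \<boxplus> l \<cdot> u2) \<cdot> y = v"
    proof (rule ex1I[of _ "t1 \<cdot> w \<boxplus> t2 \<cdot> u"])
      show "t1 \<cdot> w \<boxplus> t2 \<cdot> u \<in> homset C x (Dom C u2) \<and> u2 \<cdot> (t1 \<cdot> w \<boxplus> t2 \<cdot> u) = u
          \<and> (i \<cdot> u1 \<boxplus> l \<cdot> u2) \<cdot> (t1 \<cdot> w \<boxplus> t2 \<cdot> u) = v"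
        using h by (simp add: homset_def S U W x iw)
    next
      fix y
      assume y: "y \<in> homset C x (Dom C u2) \<and> u2 \<cdot> y = u \<and> (i \<cdot> u1 \<boxplus> l \<cdot> u2) \<cdot> y = v"
      then have yh: "y \<in> homset C x T"
        by (simp add: S)
      note Y = in_homD[OF yh]
      have y2: "u2 \<cdot> y = u"
        using y by simp
      have iy: "i \<cdot> (u1 \<cdot> y) \<boxplus> l \<cdot> u = v"
        using y by (simp add: S Y y2)
      have iy': "i \<cdot> (u1 \<cdot> y) = h"
        by (rule add_right_cancel[of _ "l \<cdot> u" h x A]) (simp_all add: homset_def h(2) iy S U Y H)
      have y1: "u1 \<cdot> y = w"
        by (rule kernel_monic[OF ker, of _ x]) (simp_all add: homset_def iw iy' S Y W)
      show "y = t1 \<cdot> w \<boxplus> t2 \<cdot> u"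
        by (rule direct_sum_ext[OF ds, of _ x]) (simp_all add: homset_def S Y W U x y1 y2)
    qed
  qed (simp_all add: S pi comp_reduce[OF pi] comp_reduce[OF l(2)])
qed

text \<open>A cone \<open>(u, v)\<close> fixes the component in \<open>P\<close> as
  \<open>u\<close>, and the component in \<open>Q\<close> can only be that of \<open>v\<close>,
  since the map is the identity there.\<close>

lemma direct_sum_map_pullback:
  assumes e: "e \<in> homset C P A"
    and dS: "is_direct_sum C P Q S j1 j2 q1 q2" and dT: "is_direct_sum C A Q T t1 t2 u1 u2"
  shows "is_pullback C e u1 q1 (t1 \<cdot> (e \<cdot> q1) \<boxplus> t2 \<cdot> q2)"
proof -
  note D = direct_sum_simps[OF dS] direct_sum_comp_simps[OF dS]
    direct_sum_simps[OF dT] direct_sum_comp_simps[OF dT] in_homD[OF e]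
  show ?thesis
    unfolding is_pullback_def
  proof (intro conjI ballI impI)
    fix x u v
    assume x: "x \<in> Obj C" and "u \<in> homset C x (Dom C e)" and "v \<in> homset C x (Dom C u1)"
      and uv: "e \<cdot> u = u1 \<cdot> v"
    then have u: "u \<in> homset C x P" and v: "v \<in> homset C x T"
      by (simp_all add: D)
    note U = in_homD[OF u] in_homD[OF v]
    let ?r = "t1 \<cdot> (e \<cdot> q1) \<boxplus> t2 \<cdot> q2" and ?w = "j1 \<cdot> u \<boxplus> j2 \<cdot> (u2 \<cdot> v)"
    show "\<exists>!w. w \<in> homset C x (Dom C q1) \<and> q1 \<cdot> w = u \<and> ?r \<cdot> w = v"
    proof (rule ex1I[of _ ?w])
      have "?r \<cdot> ?w = v"
        by (rule direct_sum_ext[OF dT, of _ x]) (simp_all add: homset_def D U x uv)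
      then show "?w \<in> homset C x (Dom C q1) \<and> q1 \<cdot> ?w = u \<and> ?r \<cdot> ?w = v"
        by (simp add: homset_def D U x)
    next
      fix y
      assume y: "y \<in> homset C x (Dom C q1) \<and> q1 \<cdot> y = u \<and> ?r \<cdot> y = v"
      then have yh: "y \<in> homset C x S"
        by (simp add: D)
      note Y = in_homD[OF yh]
      have "q2 \<cdot> y = u2 \<cdot> (?r \<cdot> y)"
        by (simp add: D Y x)
      then have qy: "q1 \<cdot> y = u" "q2 \<cdot> y = u2 \<cdot> v"
        using y by simp_all
      show "y = ?w"
        by (rule direct_sum_ext[OF dS, of _ x]) (simp_all add: homset_def D U Y x qy)
    qed
  qed (simp_all add: D)
qed

section \<open>Projective objects\<close>

lemma projective_lift:
  assumes "projective C E P" "(i, p) \<in> E" "f \<in> homset C P (Cod C p)"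
  obtains g where "g \<in> homset C P (Dom C p)" "p \<cdot> g = f"
proof -
  have "short_exact_sequence (hom_group C P (Cod C p)) (hom_group C P (Dom C p)) (hom_group C P (Dom C i))
        (\<lambda>f. p \<cdot> f) (\<lambda>f. i \<cdot> f)"
    using assms unfolding projective_def by blast
  from short_exact_sequenceD[OF this] have "(\<lambda>f. p \<cdot> f) ` homset C P (Dom C p) = homset C P (Cod C p)"
    by (simp add: epi_def hom_group_def)
  then show thesis
    using assms(3) that by (metis imageE)
qed

text \<open>Hom functors are left exact, so only surjectivity has to be checked.\<close>

lemma projectiveI:
  assumes P: "P \<in> Obj C"
    and lift: "\<And>i p f. \<lbrakk>(i, p) \<in> E; f \<in> homset C P (Cod C p)\<rbrakk> \<Longrightarrow> \<exists>g \<in> homset C P (Dom C p). p \<cdot> g = f"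
  shows "projective C E P"
  unfolding projective_def short_exact_sequence_iff
proof (intro conjI ballI, rule P, clarify, intro conjI)
  fix i p
  assume ip: "(i, p) \<in> E"
  note i = E_simps[OF ip]
  have O: "Dom C i \<in> Obj C" "Dom C p \<in> Obj C" "Cod C p \<in> Obj C"
    using i dom_closed cod_closed by auto
  let ?G1 = "hom_group C P (Dom C i)" and ?G2 = "hom_group C P (Dom C p)" and ?G3 = "hom_group C P (Cod C p)"
  have G: "group ?G1" "group ?G2" "group ?G3"
    using hom_comm_group P O comm_group.axioms(2) by blast+
  have hi: "(\<lambda>f. i \<cdot> f) \<in> hom ?G1 ?G2" and hp: "(\<lambda>f. p \<cdot> f) \<in> hom ?G2 ?G3"
    using i(1-3) by (auto simp: hom_def hom_group_def homset_def)
  have "kernel ?G2 ?G3 (\<lambda>f. p \<cdot> f) = (\<lambda>f. i \<cdot> f) ` carrier ?G1"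
  proof (intro equalityI subsetI)
    fix f
    assume "f \<in> kernel ?G2 ?G3 (\<lambda>f. p \<cdot> f)"
    then have f: "f \<in> homset C P (Dom C p)" "p \<cdot> f = Zero C P (Cod C p)"
      by (simp_all add: kernel_def hom_group_def)
    then obtain g where "g \<in> homset C P (Dom C i)" "i \<cdot> g = f"
      using kernel_lift[OF i(5), of f] in_homD[OF f(1)] by auto
    then show "f \<in> (\<lambda>f. i \<cdot> f) ` carrier ?G1"
      by (auto simp: hom_group_def)
  next
    fix f
    assume "f \<in> (\<lambda>f. i \<cdot> f) ` carrier ?G1"
    then obtain g where g: "g \<in> homset C P (Dom C i)" "f = i \<cdot> g"
      by (auto simp: hom_group_def)
    show "f \<in> kernel ?G2 ?G3 (\<lambda>f. p \<cdot> f)"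
      by (simp add: kernel_def hom_group_def homset_def g(2) in_homD[OF g(1)] i(1-3) O comp_reduce[OF i(4)])
  qed
  then show "exact_seq ([?G3, ?G2, ?G1], [\<lambda>f. p \<cdot> f, \<lambda>f. i \<cdot> f])"
    using G hi hp by (simp add: group_hom_def group_hom_axioms_def)
  have "f \<in> (\<lambda>f. p \<cdot> f) ` homset C P (Dom C p)" if "f \<in> homset C P (Cod C p)" for f
    using lift[OF ip that] by auto
  moreover have "p \<cdot> f \<in> homset C P (Cod C p)" if "f \<in> homset C P (Dom C p)" for f
    by (simp add: homset_def in_homD[OF that] i(2))
  ultimately show "(\<lambda>f. p \<cdot> f) \<in> epi ?G2 ?G3"
    using hp by (auto simp: epi_def hom_group_def)
  show "(\<lambda>f. i \<cdot> f) \<in> mon ?G1 ?G2"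
    using hi kernel_monic[OF i(5)] by (auto simp: mon_def inj_on_def hom_group_def)
qed

text \<open>Lifts of the two restrictions \<open>f \<cdot> j1\<close> and
  \<open>f \<cdot> j2\<close> assemble to a lift of \<open>f\<close>.\<close>

lemma projective_direct_sum:
  assumes "projective C E P" "projective C E Q" and ds: "is_direct_sum C P Q S j1 j2 q1 q2"
  shows "projective C E S"
proof (rule projectiveI)
  note D = direct_sum_simps[OF ds] direct_sum_comp_simps[OF ds]
  show "S \<in> Obj C"
    by (rule D)
  fix i p f
  assume ip: "(i, p) \<in> E" and f: "f \<in> homset C S (Cod C p)"
  note F = in_homD[OF f] E_simps(1-3)[OF ip] D
  have "f \<cdot> j1 \<in> homset C P (Cod C p)" "f \<cdot> j2 \<in> homset C Q (Cod C p)"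
    by (simp_all add: homset_def F)
  then obtain g1 g2 where g1: "g1 \<in> homset C P (Dom C p)" "p \<cdot> g1 = f \<cdot> j1"
    and g2: "g2 \<in> homset C Q (Dom C p)" "p \<cdot> g2 = f \<cdot> j2"
    using projective_lift[OF assms(1) ip] projective_lift[OF assms(2) ip] by metis
  note G = in_homD[OF g1(1)] in_homD[OF g2(1)]
  have O: "Cod C p \<in> Obj C" "Dom C p \<in> Obj C"
    using F dom_closed cod_closed by auto
  have "p \<cdot> (g1 \<cdot> q1 \<boxplus> g2 \<cdot> q2) = f"
    by (rule direct_sum_ext_dom[OF ds]) (simp_all add: homset_def F G O g1(2) g2(2))
  moreover have "g1 \<cdot> q1 \<boxplus> g2 \<cdot> q2 \<in> homset C S (Dom C p)"
    by (simp add: homset_def F G)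
  ultimately show "\<exists>g \<in> homset C S (Dom C p). p \<cdot> g = f"
    by blast
qed

section \<open>One step: the middle short exact sequence and the sequence of kernels\<close>

text \<open>The output \<open>(a, b)\<close> has the same shape as the input \<open>(i, p)\<close>,
  with the kernels in place of the original objects, which is what allows iteration.\<close>

lemma horseshoe_step:
  assumes ip: "(i, p) \<in> E" "i \<in> homset C A' A" "p \<in> homset C A A''"
    and e1: "(k', e') \<in> E" "k' \<in> homset C K' P'" "e' \<in> homset C P' A'"
    and e2: "(k'', e'') \<in> E" "k'' \<in> homset C K'' P''" "e'' \<in> homset C P'' A''"
    and proj: "projective C E P''"
    and ds: "is_direct_sum C P' P'' S j' j'' q' q''"
  obtains K e k a b where
    "(k, e) \<in> E" "e \<in> homset C S A" "k \<in> homset C K S"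
    "(a, b) \<in> E" "a \<in> homset C K' K" "b \<in> homset C K K''"
    "e \<cdot> j' = i \<cdot> e'" "e'' \<cdot> q'' = p \<cdot> e" "k \<cdot> a = j' \<cdot> k'" "k'' \<cdot> b = q'' \<cdot> k"
proof -
  note I = in_homD[OF ip(2)] in_homD[OF ip(3)] in_homD[OF e1(2)] in_homD[OF e1(3)]
    in_homD[OF e2(2)] in_homD[OF e2(3)]
  have O: "A' \<in> Obj C" "A \<in> Obj C" "A'' \<in> Obj C" "K' \<in> Obj C" "K'' \<in> Obj C"
    using I dom_closed cod_closed by auto
  have z: "p \<cdot> i = Zero C A' A''" "e' \<cdot> k' = Zero C K' A'" "e'' \<cdot> k'' = Zero C K'' A''"
    using E_simps(4)[OF ip(1)] E_simps(4)[OF e1(1)] E_simps(4)[OF e2(1)] by (simp_all add: I)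
  note ker_i = E_simps(5)[OF ip(1)] and ker' = E_simps(5)[OF e1(1)] and ker'' = E_simps(5)[OF e2(1)]
  obtain l where "l \<in> homset C P'' (Dom C p)" and pl: "p \<cdot> l = e''"
    using projective_lift[OF proj ip(1), of e''] e2(3) by (auto simp: I)
  then have l: "l \<in> homset C P'' A"
    by (simp add: I)
  obtain T t1 t2 u1 u2 where dT: "is_direct_sum C A' P'' T t1 t2 u1 u2"
    using direct_sum_exists[of A' P''] O direct_sum_simps(2)[OF ds] by blast
  note D = I O z z[THEN comp_reduce] in_homD[OF l] pl comp_reduce[OF pl]
    direct_sum_simps[OF ds] direct_sum_comp_simps[OF ds]
    direct_sum_simps[OF dT] direct_sum_comp_simps[OF dT]

  \<comment> \<open>\<open>f\<close> is the row \<open>[i, l]\<close>. The composite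
    \<open>f \<cdot> r\<close> gives admissibility, while the expanded form \<open>e\<close> gives
    the two squares with \<open>j'\<close> and \<open>q''\<close>.\<close>
  define f where "f = i \<cdot> u1 \<boxplus> l \<cdot> u2"
  define r where "r = t1 \<cdot> (e' \<cdot> q') \<boxplus> t2 \<cdot> q''"
  define e where "e = i \<cdot> (e' \<cdot> q') \<boxplus> l \<cdot> q''"
  have f: "f \<in> Arr C" "Dom C f = T" "Cod C f = A"
    by (simp_all add: f_def D)
  have r: "r \<in> Arr C" "Dom C r = S" "Cod C r = T" "u2 \<cdot> r = q''" "u1 \<cdot> r = e' \<cdot> q'"
    by (simp_all add: r_def D)
  have e: "e \<in> Arr C" "Dom C e = S" "Cod C e = A"
    by (simp_all add: e_def D)
  have fr: "f \<cdot> r = e"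
    by (simp add: f_def r_def e_def D)
  have ej: "e \<cdot> j' = i \<cdot> e'" and pe: "p \<cdot> e = e'' \<cdot> q''"
    by (simp_all add: e_def D)
  have "adm_epic E f"
    using adm_epic_pullback[OF _ lift_pullback[OF ip l pl dT]] e2(1)
    unfolding f_def adm_epic_def by blast
  moreover have r_epic: "adm_epic E r"
    using adm_epic_pullback[OF _ direct_sum_map_pullback[OF e1(3) ds dT]] e1(1)
    unfolding r_def adm_epic_def by blast
  ultimately have "adm_epic E e"
    using comp_adm_epic[of r f] by (simp add: fr f r)
  then obtain k where k: "(k, e) \<in> E"
    unfolding adm_epic_def by blast
  note ker_e = E_simps(5)[OF k]
  define K where "K = Dom C k"
  have kh: "k \<in> Arr C" "Dom C k = K" "Cod C k = S" "K \<in> Obj C" and ek: "e \<cdot> k = Zero C K A"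
    using E_simps[OF k] dom_closed by (auto simp: K_def e)

  \<comment> \<open>\<open>p \<cdot> (l \<cdot> k'') = e'' \<cdot> k''\<close> vanishes, so
    \<open>l \<cdot> k''\<close> factors through \<open>i\<close>; below, \<open>g\<close> is the
    negative of this factor \<open>h\<close>.\<close>
  obtain h where "h \<in> homset C (Dom C (l \<cdot> k'')) (Dom C i)" and ih: "i \<cdot> h = l \<cdot> k''"
    using kernel_lift[OF ker_i, of "l \<cdot> k''"] by (auto simp: D)
  then have h: "h \<in> homset C K'' A'"
    by (simp add: D)
  have "Zero C K'' A' \<in> homset C K'' A'"
    by (simp add: homset_def O)
  then obtain g where g: "g \<in> homset C K'' A'" and gh: "g \<boxplus> h = Zero C K'' A'"
    using obtain_diff[OF _ h] by blast
  note H = in_homD[OF h] in_homD[OF g]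
  \<comment> \<open>The component \<open>g\<close> cancels the contribution of \<open>k''\<close>
    under \<open>[i, l]\<close>, so \<open>f \<cdot> m\<close> is zero. The full kernel property of
    \<open>m\<close> is not isolated: the pull-back argument works with this equation and the
    kernels \<open>k\<close> and \<open>k''\<close>.\<close>
  define m where "m = t1 \<cdot> g \<boxplus> t2 \<cdot> k''"
  have m: "m \<in> Arr C" "Dom C m = K''" "Cod C m = T" "u1 \<cdot> m = g" "u2 \<cdot> m = k''"
    by (simp_all add: m_def D H)
  have "i \<cdot> (g \<boxplus> h) = Zero C K'' A"
    by (simp only: gh) (simp add: D)
  then have igh: "i \<cdot> g \<boxplus> l \<cdot> k'' = Zero C K'' A"
    by (simp add: D H ih)
  have fm: "f \<cdot> m = Zero C K'' A"
    by (simp add: f_def m_def D H igh)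

  obtain b where "b \<in> homset C (Dom C (q'' \<cdot> k)) (Dom C k'')" and kb: "k'' \<cdot> b = q'' \<cdot> k"
    using kernel_lift[OF ker'', of "q'' \<cdot> k"]
    by (auto simp: D kh e ek comp_reduce[OF pe[symmetric]])
  then have b: "b \<in> homset C K K''"
    by (simp add: D kh)
  obtain a where "a \<in> homset C (Dom C (j' \<cdot> k')) (Dom C k)" and ka: "k \<cdot> a = j' \<cdot> k'"
    using kernel_lift[OF ker_e, of "j' \<cdot> k'"] by (auto simp: D e comp_reduce[OF ej])
  then have a: "a \<in> homset C K' K"
    by (simp add: D kh)
  note B = in_homD[OF a] in_homD[OF b]

  \<comment> \<open>Both components are compared. For the one in \<open>A'\<close>, apply the monic
    \<open>i\<close>: after adding \<open>l \<cdot> (q'' \<cdot> k)\<close> both sides become zero,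
    one by \<open>e \<cdot> k\<close>, the other by \<open>f \<cdot> m\<close>.\<close>
  have rk: "r \<cdot> k = m \<cdot> b"
  proof (rule direct_sum_ext[OF dT, of _ K])
    have igb: "i \<cdot> (e' \<cdot> (q' \<cdot> k)) = i \<cdot> (g \<cdot> b)"
    proof (rule add_right_cancel)
      have "i \<cdot> (e' \<cdot> (q' \<cdot> k)) \<boxplus> l \<cdot> (q'' \<cdot> k) = e \<cdot> k"
        by (simp add: e_def D kh)
      also have "\<dots> = (i \<cdot> g \<boxplus> l \<cdot> k'') \<cdot> b"
        by (simp add: ek igh D B)
      finally show "i \<cdot> (e' \<cdot> (q' \<cdot> k)) \<boxplus> l \<cdot> (q'' \<cdot> k) = i \<cdot> (g \<cdot> b) \<boxplus> l \<cdot> (q'' \<cdot> k)"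
        by (simp add: D B H kb)
    qed (simp_all add: homset_def D B H kh)
    have "e' \<cdot> (q' \<cdot> k) = g \<cdot> b"
      by (rule kernel_monic[OF ker_i, of _ K]) (simp_all add: homset_def D B H kh igb)
    then show "u1 \<cdot> (r \<cdot> k) = u1 \<cdot> (m \<cdot> b)"
      by (simp add: r m r(5)[THEN comp_reduce] m(4)[THEN comp_reduce] D B kh)
    show "u2 \<cdot> (r \<cdot> k) = u2 \<cdot> (m \<cdot> b)"
      by (simp add: r m r(4)[THEN comp_reduce] m(5)[THEN comp_reduce] D B kh kb)
  qed (simp_all add: homset_def r m B kh)

  have "is_pullback C r m k b"
    unfolding is_pullback_def
  proof (intro conjI ballI impI)
    fix x u v
    assume x: "x \<in> Obj C" and "u \<in> homset C x (Dom C r)" and "v \<in> homset C x (Dom C m)"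
      and uv: "r \<cdot> u = m \<cdot> v"
    then have u: "u \<in> homset C x S" and v: "v \<in> homset C x K''"
      by (simp_all add: r m)
    note U = in_homD[OF u] in_homD[OF v] x
    \<comment> \<open>As \<open>e = f \<cdot> r\<close>, the cone condition forces
      \<open>e \<cdot> u\<close> to vanish, so \<open>u\<close> factors through \<open>k\<close>.
      That factor also maps to \<open>v\<close> under \<open>b\<close>, because \<open>k''\<close>
      is monic.\<close>
    have "e \<cdot> u = f \<cdot> (m \<cdot> v)"
      by (simp add: fr[symmetric] f r U uv)
    also have "\<dots> = Zero C x A"
      by (simp add: comp_reduce[OF fm] f m U O)
    finally obtain w where "w \<in> homset C (Dom C u) (Dom C k)" and kw: "k \<cdot> w = u"
      using kernel_lift[OF ker_e, of u] by (auto simp: U e)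
    then have w: "w \<in> homset C x K"
      by (simp add: U kh)
    note W = in_homD[OF w]
    have "u2 \<cdot> (r \<cdot> u) = u2 \<cdot> (m \<cdot> v)"
      by (simp only: uv)
    then have qu: "q'' \<cdot> u = k'' \<cdot> v"
      by (simp add: r m r(4)[THEN comp_reduce] m(5)[THEN comp_reduce] D U)
    have bw: "b \<cdot> w = v"
      by (rule kernel_monic[OF ker'', of _ x])
        (simp_all add: homset_def B W U D kh comp_reduce[OF kb] kw qu)
    show "\<exists>!w. w \<in> homset C x (Dom C k) \<and> k \<cdot> w = u \<and> b \<cdot> w = v"
    proof (rule ex1I[of _ w])
      show "w \<in> homset C x (Dom C k) \<and> k \<cdot> w = u \<and> b \<cdot> w = v"
        by (simp add: kh w kw bw)
      show "y = w" if "y \<in> homset C x (Dom C k) \<and> k \<cdot> y = u \<and> b \<cdot> y = v" for y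
        by (rule kernel_monic[OF ker_e, of _ x]) (use that in \<open>simp_all add: kh w kw\<close>)
    qed
  qed (simp_all add: r m B kh rk)
  then obtain a0 where a0: "(a0, b) \<in> E"
    using adm_epic_pullback[OF r_epic] unfolding adm_epic_def by blast

  have ba: "b \<cdot> a = Zero C K' K''"
    by (rule kernel_monic[OF ker'', of _ K'])
      (simp_all add: homset_def B D kh comp_reduce[OF kb] ka)
  \<comment> \<open>The pull-back only yields some kernel \<open>a0\<close> of \<open>b\<close>, to
    be exchanged for \<open>a\<close>. If \<open>b \<cdot> v\<close> vanishes, then
    \<open>k \<cdot> v\<close> has no component in \<open>P''\<close>; its component in
    \<open>P'\<close> is killed by \<open>e'\<close>, hence comes from \<open>K'\<close>.\<close>
  have "is_kernel C a b"
    unfolding is_kernel_def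
  proof (intro conjI ballI impI)
    fix x v
    assume x: "x \<in> Obj C" and "v \<in> homset C x (Dom C b)" and "b \<cdot> v = Zero C x (Cod C b)"
    then have v: "v \<in> homset C x K" and bv: "b \<cdot> v = Zero C x K''"
      by (simp_all add: B)
    note V = in_homD[OF v] x
    have "k'' \<cdot> (b \<cdot> v) = Zero C x P''"
      by (simp add: bv V D)
    then have qkv: "q'' \<cdot> (k \<cdot> v) = Zero C x P''"
      by (simp add: comp_reduce[OF kb] B V D kh)
    have "e' \<cdot> (q' \<cdot> (k \<cdot> v)) = Zero C x A'"
    proof (rule kernel_monic[OF ker_i, of _ x])
      have "e \<cdot> (k \<cdot> v) = Zero C x A"
        by (simp add: comp_reduce[OF ek] e kh V O)
      then show "i \<cdot> (e' \<cdot> (q' \<cdot> (k \<cdot> v))) = i \<cdot> Zero C x A'"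
        by (simp add: e_def D V kh qkv)
    qed (simp_all add: homset_def D V kh)
    then obtain y where "y \<in> homset C (Dom C (q' \<cdot> (k \<cdot> v))) (Dom C k')" and ky: "k' \<cdot> y = q' \<cdot> (k \<cdot> v)"
      using kernel_lift[OF ker', of "q' \<cdot> (k \<cdot> v)"] by (auto simp: D V kh)
    then have y: "y \<in> homset C x K'"
      by (simp add: D V kh)
    note Y = in_homD[OF y]
    have jky: "j' \<cdot> (k' \<cdot> y) = k \<cdot> v"
      by (rule direct_sum_ext[OF ds, of _ x]) (simp_all add: homset_def D V kh Y qkv ky)
    have ay: "a \<cdot> y = v"
      by (rule kernel_monic[OF ker_e, of _ x])
        (simp_all add: homset_def B Y V D kh comp_reduce[OF ka] jky)
    have uniq: "y' = y" if y': "y' \<in> homset C x K'" "a \<cdot> y' = v" for y'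
    proof (rule kernel_monic[OF ker', of _ x])
      note Y' = in_homD[OF y'(1)]
      have "q' \<cdot> (k \<cdot> (a \<cdot> y')) = q' \<cdot> (k \<cdot> (a \<cdot> y))"
        by (simp only: y'(2) ay)
      then show "k' \<cdot> y' = k' \<cdot> y"
        by (simp add: comp_reduce[OF ka] B Y Y' D kh)
    qed (simp_all add: D y y'(1))
    show "\<exists>!y. y \<in> homset C x (Dom C a) \<and> a \<cdot> y = v"
      unfolding B(2) using y ay uniq by blast
  qed (simp_all add: B D kh ba)
  then have ab: "(a, b) \<in> E"
    using E_kernel[OF a0] by blast
  show thesis
    by (rule that[OF k _ _ ab a b ej pe[symmetric] ka kb]) (simp_all add: homset_def e kh)
qed

section \<open>Vanishing in negative degrees, and resolutions as spliced short exact
  sequences\<close>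

lemma zero_object_direct_sum:
  assumes "is_zero_object C a" "is_zero_object C b" and ds: "is_direct_sum C a b s j1 j2 q1 q2"
  shows "is_zero_object C s"
  unfolding is_zero_object_def
proof (intro conjI ballI)
  note D = direct_sum_simps[OF ds]
  show "s \<in> Obj C"
    by (rule D)
  fix x
  assume x: "x \<in> Obj C"
  have "f = g" if fg: "f \<in> homset C s x" "g \<in> homset C s x" for f g
  proof (rule direct_sum_ext_dom[OF ds fg])
    note F = in_homD[OF fg(1)] in_homD[OF fg(2)]
    show "f \<cdot> j1 = g \<cdot> j1"
      by (rule zero_object_eq_dom[OF assms(1), of _ x]) (simp_all add: homset_def D F)
    show "f \<cdot> j2 = g \<cdot> j2"
      by (rule zero_object_eq_dom[OF assms(2), of _ x]) (simp_all add: homset_def D F)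
  qed
  moreover have "Zero C s x \<in> homset C s x"
    by (simp add: homset_def D x)
  ultimately show "\<exists>!f. f \<in> homset C s x"
    by blast
  have "f = g" if fg: "f \<in> homset C x s" "g \<in> homset C x s" for f g
  proof (rule direct_sum_ext[OF ds fg])
    note F = in_homD[OF fg(1)] in_homD[OF fg(2)]
    show "q1 \<cdot> f = q1 \<cdot> g"
      by (rule zero_object_eq[OF assms(1), of _ x]) (simp_all add: homset_def D F)
    show "q2 \<cdot> f = q2 \<cdot> g"
      by (rule zero_object_eq[OF assms(2), of _ x]) (simp_all add: homset_def D F)
  qed
  moreover have "Zero C x s \<in> homset C x s"
    by (simp add: homset_def D x)
  ultimately show "\<exists>!f. f \<in> homset C x s"
    by blast
qed

lemma E_iso_cod:
  assumes "(i, p) \<in> E" "is_iso C a" "a \<in> homset C (Cod C p) x"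
  shows "(i, a \<cdot> p) \<in> E"
proof -
  note S = E_simps(1-3)[OF assms(1)] in_homD[OF assms(3)]
  have O: "Dom C i \<in> Obj C" "Dom C p \<in> Obj C"
    using S dom_closed by auto
  show ?thesis
    by (rule E_iso_closed[OF assms(1), of _ _ "Id C (Dom C i)" "Id C (Dom C p)" a])
      (simp_all add: homset_def is_iso_Id assms(2) S O)
qed

text \<open>The chain condition comes for free: two consecutive differentials contain the composite
  \<open>e (n - 1) \<cdot> m (n - 1)\<close> of a short exact sequence.\<close>

lemma exact_complexI:
  assumes e: "\<And>n. e n \<in> homset C (X n) (Z (n - 1))" and m: "\<And>n. m n \<in> homset C (Z n) (X n)"
    and d: "\<And>n. d n = m (n - 1) \<cdot> e n" and E: "\<And>n. (m n, e n) \<in> E"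
  shows "exact_complex C E X d"
proof -
  note S = in_homD[OF e] in_homD[OF m]
  have O: "X n \<in> Obj C" "Z n \<in> Obj C" for n
    using dom_closed[of "e n"] dom_closed[of "m n"] by (simp_all add: S)
  have em: "e n \<cdot> m n = Zero C (Z n) (Z (n - 1))" for n
    using E_simps(4)[OF E[of n]] by (simp add: S)
  have "d (n - 1) \<cdot> d n = Zero C (X n) (X (n - 2))" for n
    by (simp add: d S O comp_reduce[OF em])
  then have "chain_complex C X d"
    unfolding chain_complex_def by (simp add: O) (simp add: homset_def d S)
  then show ?thesis
    unfolding exact_complex_def using assms by blast
qed

text \<open>Exactness in degree -1 only provides an image object isomorphic to \<open>A\<close>.
  Absorbing that isomorphism into the augmentation yields sequences indexed by naturals that start
  exactly at \<open>A\<close> and \<open>eps\<close>.\<close>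

lemma resolution_splice:
  assumes "projective_resolution C E P d eps A"
  obtains Z k e where "Z 0 = A" "e 0 = eps"
    "\<And>n::nat. (k n, e n) \<in> E" "\<And>n. k n \<in> homset C (Z (Suc n)) (P (int n))"
    "\<And>n. e n \<in> homset C (P (int n)) (Z n)" "\<And>n. d (1 + int n) = k n \<cdot> e (Suc n)"
proof -
  have P0: "is_zero_object C (P (-2))" and A: "A \<in> Obj C" and eps: "eps \<in> homset C (P 0) A"
    using assms by (simp_all add: projective_resolution_def)
  obtain Z e m where *: "\<And>n. e n \<in> homset C (aug_obj P A n) (Z (n - 1))"
    "\<And>n. m n \<in> homset C (Z n) (aug_obj P A n)" "\<And>n. aug_diff C P d eps A n = m (n - 1) \<cdot> e n"
    "\<And>n. (m n, e n) \<in> E"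
    using assms unfolding projective_resolution_def exact_complex_def by blast
  have m2: "m (-2) \<in> homset C (Z (-2)) (P (-2))" and m1: "m (-1) \<in> homset C (Z (-1)) A"
    and e1: "e (-1) \<in> homset C A (Z (-2))" and e0: "e 0 \<in> homset C (P 0) (Z (-1))"
    using *(1)[of "-1"] *(1)[of 0] *(2)[of "-2"] *(2)[of "-1"] by (simp_all add: aug_obj_def)
  note S = in_homD[OF m2] in_homD[OF m1] in_homD[OF e1] in_homD[OF e0]
  have O: "Z (-1) \<in> Obj C" "Z (-2) \<in> Obj C" "P (-2) \<in> Obj C"
    using dom_closed[of "m (-1)"] cod_closed[of "e (-1)"] cod_closed[of "m (-2)"] by (simp_all add: S)
  \<comment> \<open>Both composites end in a zero object; as \<open>m (-2)\<close> is monic,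
    \<open>e (-1)\<close> vanishes. Its kernel \<open>m (-1)\<close> then admits a lift of the
    identity of \<open>A\<close>, which makes it an isomorphism.\<close>
  have me: "m (-2) \<cdot> e (-1) = m (-2) \<cdot> Zero C A (Z (-2))"
    by (rule zero_object_eq[OF P0, of _ A]) (simp_all add: homset_def S A O)
  have "e (-1) = Zero C A (Z (-2))"
    by (rule kernel_monic[OF E_simps(5)[OF *(4)[of "-2"]], of _ A])
      (simp_all add: homset_def S A O me)
  then obtain s where "s \<in> homset C (Dom C (Id C A)) (Dom C (m (-1)))" and ms: "m (-1) \<cdot> s = Id C A"
    using kernel_lift[OF E_simps(5)[OF *(4)[of "-1"]], of "Id C A"] by (auto simp: S A O)
  then have s: "s \<in> homset C A (Z (-1))"
    by (simp add: S A)
  have "s \<cdot> m (-1) = Id C (Z (-1))"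
    by (rule kernel_monic[OF E_simps(5)[OF *(4)[of "-1"]], of _ "Z (-1)"])
      (simp_all add: homset_def S in_homD[OF s] O comp_reduce[OF ms])
  then have "is_iso C (m (-1))"
    using is_isoI[OF m1 s] ms by blast
  then have "(m 0, m (-1) \<cdot> e 0) \<in> E"
    using E_iso_cod[OF *(4)[of 0]] m1 by (simp add: S)
  moreover have "eps = m (-1) \<cdot> e 0"
    using *(3)[of 0] by (simp add: aug_diff_def)
  ultimately have eps_E: "(m 0, eps) \<in> E"
    by simp
  \<comment> \<open>The index shifts by one: the object numbered \<open>n\<close> is the
    integer-indexed \<open>Z (n - 1)\<close>, except that \<open>A\<close> replaces
    \<open>Z (-1)\<close>.\<close>
  show thesis
  proof (rule that[of "\<lambda>n. if n = 0 then A else Z (int n - 1)" "\<lambda>n. if n = 0 then eps else e (int n)"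
        "\<lambda>n. m (int n)"])
    fix n
    show "(m (int n), if n = 0 then eps else e (int n)) \<in> E"
      using *(4)[of "int n"] eps_E by simp
    show "m (int n) \<in> homset C (if Suc n = 0 then A else Z (int (Suc n) - 1)) (P (int n))"
      using *(2)[of "int n"] by (simp add: aug_obj_def)
    show "(if n = 0 then eps else e (int n)) \<in> homset C (P (int n)) (if n = 0 then A else Z (int n - 1))"
      using *(1)[of "int n"] eps by (simp add: aug_obj_def)
    show "d (1 + int n) = m (int n) \<cdot> (if Suc n = 0 then eps else e (int (Suc n)))"
      using *(3)[of "1 + int n"] by (simp add: aug_diff_def)
  qed simp_all
qed

text \<open>Converse of the splitting into short exact sequences: they are extended to all integers
  by identities followed by zero arrows.\<close>

lemma projective_resolutionI:
  assumes proj: "\<And>n. projective C E (P n)" and zero: "\<And>n. n < 0 \<Longrightarrow> is_zero_object C (P n)"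
    and Z0: "Z 0 = A"
    and E: "\<And>n::nat. (k n, e n) \<in> E" and k: "\<And>n. k n \<in> homset C (Z (Suc n)) (P (int n))"
    and e: "\<And>n. e n \<in> homset C (P (int n)) (Z n)"
    and dh: "\<And>n. d n \<in> homset C (P n) (P (n - 1))" and d: "\<And>n. d (1 + int n) = k n \<cdot> e (Suc n)"
  shows "projective_resolution C E P d (e 0) A"
proof -
  note S = in_homD[OF k] in_homD[OF e] in_homD[OF dh]
  have O: "P n \<in> Obj C" "Z j \<in> Obj C" for n j
    using proj[of n] cod_closed[of "e j"] by (simp_all add: S projective_def)
  have A: "A \<in> Obj C"
    using O(2)[of 0] Z0 by simp
  have ek: "e n \<cdot> k n = Zero C (Z (Suc n)) (Z n)" for n
    using E_simps(4)[OF E[of n]] by (simp add: S)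
  \<comment> \<open>From degree 2 on, the composite contains consecutive arrows of one short exact
    sequence; below that, its target is a zero object.\<close>
  have "d (n - 1) \<cdot> d n = Zero C (P n) (P (n - 2))" for n
  proof (cases "n \<ge> 2")
    case True
    then have "n = 1 + int (Suc (nat (n - 2)))"
      by simp
    then obtain j where j: "n = 1 + int (Suc j)"
      by blast
    have "d (n - 1) \<cdot> d n = (k j \<cdot> e (Suc j)) \<cdot> (k (Suc j) \<cdot> e (Suc (Suc j)))"
      using d[of j] d[of "Suc j"] by (simp add: j del: comp_assoc_right)
    also have "\<dots> = Zero C (P n) (P (n - 2))"
      using S(5)[of "Suc (Suc j)"] by (simp add: S O comp_reduce[OF ek] j)
    finally show ?thesis .
  next
    case False
    then show ?thesis
      by (intro zero_object_eq[OF zero[of "n - 2"], of _ "P n"]) (simp_all add: homset_def S O)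
  qed
  then have "chain_complex C P d"
    using dh O by (simp add: chain_complex_def)
  moreover have "exact_complex C E (aug_obj P A) (aug_diff C P d (e 0) A)"
  proof -
    let ?X = "aug_obj P A"
    \<comment> \<open>The shift is chosen so that \<open>Z' (-1)\<close> is \<open>A\<close>,
      matching \<open>Z 0\<close>. In each negative degree the sequence is an identity followed by
      the arrow to a zero object.\<close>
    define Z' where "Z' n = (if n \<ge> 0 then Z (Suc (nat n)) else ?X n)" for n
    define m where "m n = (if n \<ge> 0 then k (nat n) else Id C (?X n))" for n
    define f where "f n = (if n \<ge> 0 then e (nat n) else Zero C (?X n) (?X (n - 1)))" for n
    have X: "?X n \<in> Obj C" for n
      by (simp add: aug_obj_def A O)
    have X_int: "?X (int j) = P (int j)" for j
      by (simp add: aug_obj_def)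
    have Z'_int: "Z' (int j - 1) = Z j" for j
      by (cases j) (simp_all add: Z'_def Z0 aug_obj_def)
    have z: "is_zero_object C (?X (n - 1))" if "n < 0" for n
      using zero[of "n - 1"] that by (simp add: aug_obj_def)
    show ?thesis
    proof (rule exact_complexI)
      fix n
      show f: "f n \<in> homset C (?X n) (Z' (n - 1))"
      proof (cases "n \<ge> 0")
        case True
        then obtain j where "n = int j"
          using zero_le_imp_eq_int by blast
        then show ?thesis
          using e[of j] by (simp add: f_def X_int Z'_int)
      next
        case False
        then show ?thesis
          by (simp add: f_def Z'_def homset_def X)
      qed
      show "m n \<in> homset C (Z' n) (?X n)"
      proof (cases "n \<ge> 0")
        case True
        then obtain j where "n = int j"
          using zero_le_imp_eq_int by blast
        then show ?thesis
          using k[of j] by (simp add: m_def X_int Z'_def)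
      next
        case False
        then show ?thesis
          by (simp add: m_def Z'_def homset_def X)
      qed
      show "(m n, f n) \<in> E"
        using Id_Zero_in_E[OF X z, of n n] E by (simp add: m_def f_def)
      show "aug_diff C P d (e 0) A n = m (n - 1) \<cdot> f n"
      proof (cases "n \<ge> 0")
        case True
        then obtain j where j: "n = int j"
          using zero_le_imp_eq_int by blast
        show ?thesis
        proof (cases j)
          case 0
          then show ?thesis
            by (simp add: j aug_diff_def m_def f_def aug_obj_def S Z0)
        next
          case (Suc t)
          then show ?thesis
            using d[of t] by (simp add: j aug_diff_def m_def f_def nat_add_distrib)
        qed
      next
        case False
        \<comment> \<open>In negative degrees both sides are arrows into the same zero
          object.\<close>
        have "aug_diff C P d (e 0) A n \<in> homset C (?X n) (?X (n - 1))"
          using False by (simp add: aug_diff_def aug_obj_def homset_def S A O)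
        moreover have "m (n - 1) \<cdot> f n \<in> homset C (?X n) (?X (n - 1))"
          using False by (simp add: m_def f_def homset_def X)
        ultimately show ?thesis
          using zero_object_eq[OF z[of n]] False by simp
      qed
    qed
  qed
  ultimately show ?thesis
    using proj zero A e[of 0] by (simp add: projective_resolution_def Z0)
qed

section \<open>Iteration of the step and assembly of the middle resolution\<close>

lemma horseshoe:
  assumes ip: "(i, p) \<in> E" "i \<in> homset C A' A" "p \<in> homset C A A''"
    and res': "projective_resolution C E P' d' eps' A'"
    and res'': "projective_resolution C E P'' d'' eps'' A''"
    and ds: "\<And>n. is_direct_sum C (P' n) (P'' n) (P n) (j' n) (j'' n) (q' n) (q'' n)"
  shows "\<exists>d eps. projective_resolution C E P d eps A \<and>
    (\<forall>n. (j' n, q'' n) \<in> E) \<and>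
    (\<forall>n. d n \<cdot> j' n = j' (n - 1) \<cdot> d' n) \<and>
    (\<forall>n. d'' n \<cdot> q'' n = q'' (n - 1) \<cdot> d n) \<and>
    eps \<cdot> j' 0 = i \<cdot> eps' \<and>
    eps'' \<cdot> q'' 0 = p \<cdot> eps"
proof -
  have zero': "is_zero_object C (P' n)" and zero'': "is_zero_object C (P'' n)" if "n < 0" for n
    using res' res'' that by (simp_all add: projective_resolution_def)
  have proj': "projective C E (P' n)" and proj'': "projective C E (P'' n)" for n
    using res' res'' by (simp_all add: projective_resolution_def)
  have hom': "d' n \<in> homset C (P' n) (P' (n - 1))" and hom'': "d'' n \<in> homset C (P'' n) (P'' (n - 1))" for n
    using res' res'' by (simp_all add: projective_resolution_def chain_complex_def)
  have zero: "is_zero_object C (P n)" if "n < 0" for n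
    using zero_object_direct_sum[OF zero' zero'' ds] that by blast
  have proj: "projective C E (P n)" for n
    using projective_direct_sum[OF proj' proj'' ds] .
  note D = direct_sum_simps[OF ds]

  obtain Z' k' e' where Z'0: "Z' 0 = A'" and e'0: "e' 0 = eps'"
    and E': "\<And>n::nat. (k' n, e' n) \<in> E" and k': "\<And>n. k' n \<in> homset C (Z' (Suc n)) (P' (int n))"
    and e': "\<And>n. e' n \<in> homset C (P' (int n)) (Z' n)" and d': "\<And>n. d' (1 + int n) = k' n \<cdot> e' (Suc n)"
    by (rule resolution_splice[OF res']) (rule that)
  obtain Z'' k'' e'' where Z''0: "Z'' 0 = A''" and e''0: "e'' 0 = eps''"
    and E'': "\<And>n::nat. (k'' n, e'' n) \<in> E" and k'': "\<And>n. k'' n \<in> homset C (Z'' (Suc n)) (P'' (int n))"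
    and e'': "\<And>n. e'' n \<in> homset C (P'' (int n)) (Z'' n)" and d'': "\<And>n. d'' (1 + int n) = k'' n \<cdot> e'' (Suc n)"
    by (rule resolution_splice[OF res'']) (rule that)

  \<comment> \<open>A state is the current short exact sequence of kernels. Dependent choice does
    not prescribe its first element, so the clause for \<open>n = 0\<close> pins it to
    \<open>(A, i, p)\<close>.\<close>
  let ?inv = "\<lambda>n (Z, a, b). (a, b) \<in> E \<and> a \<in> homset C (Z' n) Z \<and> b \<in> homset C Z (Z'' n) \<and>
    (n = 0 \<longrightarrow> (Z, a, b) = (A, i, p))"
  let ?step = "\<lambda>n (Z, a, b) (Y, a', b'). \<exists>k e. (k, e) \<in> E \<and> e \<in> homset C (P (int n)) Z \<and>
    k \<in> homset C Y (P (int n)) \<and> e \<cdot> j' (int n) = a \<cdot> e' n \<and> e'' n \<cdot> q'' (int n) = b \<cdot> e \<and>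
    k \<cdot> a' = j' (int n) \<cdot> k' n \<and> k'' n \<cdot> b' = q'' (int n) \<cdot> k"
  have "\<exists>F. \<forall>n. ?inv n (F n) \<and> ?step n (F n) (F (Suc n))"
  proof (rule dependent_nat_choice)
    show "\<exists>x. ?inv 0 x"
      using ip Z'0 Z''0 by (intro exI[of _ "(A, i, p)"]) simp
  next
    fix x n
    assume x: "?inv n x"
    obtain Z a b where xz: "x = (Z, a, b)"
      by (cases x)
    have ab: "(a, b) \<in> E" "a \<in> homset C (Z' n) Z" "b \<in> homset C Z (Z'' n)"
      using x xz by auto
    obtain Y e k a' b' where "(k, e) \<in> E" "e \<in> homset C (P (int n)) Z" "k \<in> homset C Y (P (int n))"
      "(a', b') \<in> E" "a' \<in> homset C (Z' (Suc n)) Y" "b' \<in> homset C Y (Z'' (Suc n))"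
      "e \<cdot> j' (int n) = a \<cdot> e' n" "e'' n \<cdot> q'' (int n) = b \<cdot> e"
      "k \<cdot> a' = j' (int n) \<cdot> k' n" "k'' n \<cdot> b' = q'' (int n) \<cdot> k"
      by (rule horseshoe_step[OF ab E' k' e' E'' k'' e'' proj'' ds])
    then show "\<exists>y. ?inv (Suc n) y \<and> ?step n x y"
      unfolding xz by (intro exI[of _ "(Y, a', b')"]) auto
  qed
  then obtain F where F: "\<forall>n. ?inv n (F n) \<and> ?step n (F n) (F (Suc n))" ..
  define Z a b where "Z n = fst (F n)" and "a n = fst (snd (F n))" and "b n = snd (snd (F n))" for n
  have F_eq: "F n = (Z n, a n, b n)" for n
    by (simp add: Z_def a_def b_def)
  have ab: "a n \<in> homset C (Z' n) (Z n)" "b n \<in> homset C (Z n) (Z'' n)" for n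
    using F[THEN spec, THEN conjunct1, of n] by (simp_all add: F_eq)
  have init: "Z 0 = A" "a 0 = i" "b 0 = p"
    using F[THEN spec, THEN conjunct1, of 0] by (simp_all add: F_eq)
  \<comment> \<open>The arrows \<open>k\<close> and \<open>e\<close> are not part of the state; they
    are chosen once all the kernel sequences are fixed.\<close>
  have "\<forall>n. \<exists>k e. (k, e) \<in> E \<and> e \<in> homset C (P (int n)) (Z n) \<and>
    k \<in> homset C (Z (Suc n)) (P (int n)) \<and> e \<cdot> j' (int n) = a n \<cdot> e' n \<and> e'' n \<cdot> q'' (int n) = b n \<cdot> e \<and>
    k \<cdot> a (Suc n) = j' (int n) \<cdot> k' n \<and> k'' n \<cdot> b (Suc n) = q'' (int n) \<cdot> k"
    using F[THEN spec, THEN conjunct2] by (simp add: F_eq)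
  then obtain k e where E: "\<And>n. (k n, e n) \<in> E" and e: "\<And>n. e n \<in> homset C (P (int n)) (Z n)"
    and k: "\<And>n. k n \<in> homset C (Z (Suc n)) (P (int n))"
    and ej: "\<And>n. e n \<cdot> j' (int n) = a n \<cdot> e' n" and eq: "\<And>n. e'' n \<cdot> q'' (int n) = b n \<cdot> e n"
    and ka: "\<And>n. k n \<cdot> a (Suc n) = j' (int n) \<cdot> k' n" and kb: "\<And>n. k'' n \<cdot> b (Suc n) = q'' (int n) \<cdot> k n"
    by metis

  \<comment> \<open>The differential passes through the kernel \<open>Z n\<close> of the preceding
    step; from degree 0 downwards its target is a zero object.\<close>
  define d where "d n = (if n \<ge> 1 then k (nat (n - 1)) \<cdot> e (nat n) else Zero C (P n) (P (n - 1)))" for n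
  have d_int: "d (1 + int n) = k n \<cdot> e (Suc n)" for n
    by (simp add: d_def nat_add_distrib)
  note S = in_homD[OF k] in_homD[OF e] in_homD[OF k'] in_homD[OF e'] in_homD[OF k''] in_homD[OF e'']
    in_homD[OF ab(1)] in_homD[OF ab(2)] D
  have pos: "\<exists>t. n = 1 + int t" if "n \<ge> 1" for n :: int
    using that by (intro exI[of _ "nat (n - 1)"]) simp
  have dh: "d n \<in> homset C (P n) (P (n - 1))" for n
  proof (cases "n \<ge> 1")
    case True
    then obtain t where t: "n = 1 + int t"
      using pos by blast
    show ?thesis
      using S(5)[of "Suc t"] by (simp add: t d_int homset_def S)
  next
    case False
    then show ?thesis
      by (simp add: d_def homset_def D)
  qed
  have dj: "d n \<cdot> j' n = j' (n - 1) \<cdot> d' n" and dq: "d'' n \<cdot> q'' n = q'' (n - 1) \<cdot> d n" for n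
  proof (atomize (full), cases "n \<ge> 1")
    case True
    then obtain t where t: "n = 1 + int t"
      using pos by blast
    have n: "n = int (Suc t)"
      by (simp add: t)
    \<comment> \<open>These instances bring the domain index \<open>int (Suc t)\<close> to the form
      \<open>1 + int t\<close> used for \<open>d\<close>. Each square then splits at the kernels,
      into a square with \<open>e\<close> and one with \<open>k\<close>.\<close>
    note T = S(5)[of "Suc t"] S(11)[of "Suc t"] S(17)[of "Suc t"]
    have "d n \<cdot> j' n = k t \<cdot> (e (Suc t) \<cdot> j' n)"
      using T by (simp add: t d_int S)
    also have "\<dots> = (k t \<cdot> a (Suc t)) \<cdot> e' (Suc t)"
      using T by (simp add: n ej S del: of_nat_Suc)
    also have "\<dots> = j' (n - 1) \<cdot> d' n"
      using T by (simp only: ka) (simp add: t d' S)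
    finally have 1: "d n \<cdot> j' n = j' (n - 1) \<cdot> d' n" .
    have "d'' n \<cdot> q'' n = k'' t \<cdot> (e'' (Suc t) \<cdot> q'' n)"
      using T by (simp add: t d'' S)
    also have "\<dots> = (k'' t \<cdot> b (Suc t)) \<cdot> e (Suc t)"
      using T by (simp add: n eq S del: of_nat_Suc)
    also have "\<dots> = q'' (n - 1) \<cdot> d n"
      using T by (simp only: kb) (simp add: t d_int S)
    finally show "d n \<cdot> j' n = j' (n - 1) \<cdot> d' n \<and> d'' n \<cdot> q'' n = q'' (n - 1) \<cdot> d n"
      using 1 by blast
  next
    case False
    then have "n - 1 < 0"
      by simp
    \<comment> \<open>Both squares now end in a zero object and commute trivially.\<close>
    note z = zero[OF this] zero''[OF this]
    note H = in_homD[OF dh] in_homD[OF hom'] in_homD[OF hom''] D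
    have "d n \<cdot> j' n = j' (n - 1) \<cdot> d' n"
      by (rule zero_object_eq[OF z(1), of _ "P' n"]) (simp_all add: homset_def H)
    moreover have "d'' n \<cdot> q'' n = q'' (n - 1) \<cdot> d n"
      by (rule zero_object_eq[OF z(2), of _ "P n"]) (simp_all add: homset_def H)
    ultimately show "d n \<cdot> j' n = j' (n - 1) \<cdot> d' n \<and> d'' n \<cdot> q'' n = q'' (n - 1) \<cdot> d n"
      by blast
  qed
  have "projective_resolution C E P d (e 0) A"
    by (rule projective_resolutionI[OF proj zero init(1) E k e dh d_int])
  moreover have "e 0 \<cdot> j' 0 = i \<cdot> eps'" "eps'' \<cdot> q'' 0 = p \<cdot> e 0"
    using ej[of 0] eq[of 0] by (simp_all add: init e'0 e''0)
  ultimately show ?thesis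
    using direct_sum_in_E[OF ds] dj dq by blast
qed

end

theorem theorem12p8:
  fixes C :: "('o, 'm, 'z) preadd_scheme" (structure)
    and E :: "('m \<times> 'm) set"
    and A' A A'' :: 'o
    and i p :: 'm
    and P' P'' P :: "int \<Rightarrow> 'o"
    and d' d'' :: "int \<Rightarrow> 'm"
    and eps' eps'' :: 'm
    and j' j'' q' q'' :: "int \<Rightarrow> 'm"
  assumes "exact_category C E"
    and "(i, p) \<in> E" and "i \<in> homset C A' A" and "p \<in> homset C A A''"
    and "projective_resolution C E P' d' eps' A'"
    and "projective_resolution C E P'' d'' eps'' A''"
    and "\<And>n. is_direct_sum C (P' n) (P'' n) (P n) (j' n) (j'' n) (q' n) (q'' n)"
  shows "\<exists>d eps. projective_resolution C E P d eps A \<and>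
    (\<forall>n. (j' n, q'' n) \<in> E) \<and>
    (\<forall>n. d n \<cdot> j' n = j' (n - 1) \<cdot> d' n) \<and>
    (\<forall>n. d'' n \<cdot> q'' n = q'' (n - 1) \<cdot> d n) \<and>
    eps \<cdot> j' 0 = i \<cdot> eps' \<and>
    eps'' \<cdot> q'' 0 = p \<cdot> eps"
  by (rule exact_category.horseshoe[OF assms])

end
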